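(* Let $a_n$ be the number of permutations of $[n]$ that strongly avoid the pattern $132$. The growth rate of $a_n$ is $2$, i.e. $\lim_{n\to\infty}a_n^{1/n}=2$; furthermore, $a_n<2^n$ for all sufficiently large $n$.
   Context: A permutation $\pi=\pi_1\pi_2\cdots\pi_n$ of $[n]=\{1,\dots,n\}$ (one-line notation, $\pi_i=\pi(i)$) avoids $132$ if there are no indices $i<j<k$ with $\pi_i<\pi_k<\pi_j$. The permutation $\pi$ strongly avoids $132$ if both $\pi$ and $\pi^2=\pi\circ\pi$ avoid $132$. The growth rate of a sequence $(a_n)$ is $\lim_{n\to\infty}a_n^{1/n}$. *)

theory Defs
  imports Complex_Main "HOL-Combinatorics.Permutations"
begin

definition avoids132 :: "nat \<Rightarrow> (nat \<Rightarrow> nat) \<Rightarrow> bool" where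
  "avoids132 n p \<longleftrightarrow>
     \<not> (\<exists>i\<in>{1..n}. \<exists>j\<in>{1..n}. \<exists>k\<in>{1..n}. i < j \<and> j < k \<and> p i < p k \<and> p k < p j)"

definition strongly_avoids132 :: "nat \<Rightarrow> (nat \<Rightarrow> nat) \<Rightarrow> bool" where
  "strongly_avoids132 n p \<longleftrightarrow> avoids132 n p \<and> avoids132 n (p \<circ> p)"

definition num_strongly_avoiding132 :: "nat \<Rightarrow> nat" where
  "num_strongly_avoiding132 n = card {p. p permutes {1..n} \<and> strongly_avoids132 n p}"

end

theory Submission
  imports Defs "HOL-Real_Asymp.Real_Asymp"
begin

text \<open>
  Every 132-avoiding involution avoids 132 strongly, and the number of these satisfies a linear recursion
  whose coefficients are the numbers of 132-avoiders; it follows that it grows like 2 ^ n up to a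
  subexponential factor that tends to 0.

  For the upper bound, let p be a strong 132-avoider of [n] with p k = n and p n = m. If m = n, remove
  the last point. If k = m, then p is an involution. Up to inversion this leaves k < m < n. There, either
  p m = k, and p permutes cyclically three blocks of length k whose removal leaves a smaller strong
  avoider, or p belongs to a class of size at most about 4 powr (n / 3). Normalised by 2 ^ n, the resulting
  recursive inequality is contracting and its inhomogeneous part, consisting of the involutions and the
  exceptional class, tends to 0. Hence so does the number of strong avoiders divided by 2 ^ n.
\<close>

section \<open>Basic facts on 132-avoiding permutations\<close>

text \<open>The three-cycles resist a plain recursion on the number of strong avoiders. Removing a
  block of size \<open>k\<close> loses the place \<open>m\<close> of its middle third, and the
  number of places compatible with the same remaining pattern is controlled only by its cuts: apart
  from the extreme \<open>m = n - k\<close>, each place is a cut of that pattern. What saves the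
  count is that reinsertion at the i-th cut leaves at most i + 1 cuts, so patterns offering many
  choices are themselves rare. The levels by number of cuts, weighted by powers of 5, make this
  precise. A block uses up \<open>3 * k\<close> points, hence a factor \<open>8 ^ k\<close> against
  \<open>2 ^ n\<close>, while its content is a single 132-avoider of size \<open>k - 1\<close>. The
  Catalan series at 1/8 is small enough to survive the doubling for inverses and the loss from
  summing over levels. The involutions behave differently: divided by \<open>2 ^ n\<close>, their
  recursion has total weight 1/2 + 2/4 = 1. This criticality gives growth rate 2 from below, but no
  contraction; that their ratio tends to 0 comes from exact doubling identities and from the Catalan
  series at 1/4 summing to exactly 2.\<close>

definition avoiders :: "nat \<Rightarrow> (nat \<Rightarrow> nat) set" where
  "avoiders n = {p. p permutes {1..n} \<and> avoids132 n p}"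

definition strong_avoiders :: "nat \<Rightarrow> (nat \<Rightarrow> nat) set" where
  "strong_avoiders n = {p. p permutes {1..n} \<and> strongly_avoids132 n p}"

definition avoiding_involutions :: "nat \<Rightarrow> (nat \<Rightarrow> nat) set" where
  "avoiding_involutions n = {p \<in> avoiders n. \<forall>x. p (p x) = x}"

lemma avoids132D:
  assumes "avoids132 n p" "1 \<le> i" "i < j" "j < k" "k \<le> n" "p i < p k" "p k < p j"
  shows False
  using assms unfolding avoids132_def by force

lemma avoids132I:
  assumes "\<And>i j k. 1 \<le> i \<Longrightarrow> i < j \<Longrightarrow> j < k \<Longrightarrow> k \<le> n \<Longrightarrow> p i < p k \<Longrightarrow> p k < p j \<Longrightarrow> False"
  shows "avoids132 n p"
  using assms unfolding avoids132_def by auto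

lemma permutes_bounds:
  assumes "p permutes {1..n}" "1 \<le> x" "x \<le> n"
  shows "1 \<le> p x" "p x \<le> n"
  using permutes_in_image[OF assms(1), of x] assms by auto

lemma permutes_eq_iff:
  assumes "p permutes S" shows "p x = p y \<longleftrightarrow> x = y"
  using permutes_inj[OF assms] by (auto dest: injD)

lemma permutes_preimage:
  assumes "p permutes {1..n}" "1 \<le> y" "y \<le> n"
  obtains x where "1 \<le> x" "x \<le> n" "p x = y"
proof -
  have "y \<in> p ` {1..n}" using permutes_image[OF assms(1)] assms by auto
  then show ?thesis using that by auto
qed

lemma permutes_atLeastAtMostI:
  fixes f :: "nat \<Rightarrow> nat"
  assumes "\<And>x. 1 \<le> x \<Longrightarrow> x \<le> n \<Longrightarrow> 1 \<le> f x \<and> f x \<le> n"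
    and "\<And>x y. 1 \<le> x \<Longrightarrow> x < y \<Longrightarrow> y \<le> n \<Longrightarrow> f x \<noteq> f y"
    and "\<And>x. x = 0 \<or> x > n \<Longrightarrow> f x = x"
  shows "f permutes {1..n}"
proof (rule bij_imp_permutes)
  have "inj_on f {1..n}"
  proof (rule inj_onI)
    fix x y assume "x \<in> {1..n}" "y \<in> {1..n}" "f x = f y"
    then show "x = y" using assms(2)[of x y] assms(2)[of y x] by (cases x y rule: linorder_cases) auto
  qed
  moreover have "f ` {1..n} \<subseteq> {1..n}" using assms(1) by auto
  ultimately show "bij_betw f {1..n} {1..n}"
    by (simp add: bij_betw_def endo_inj_surj)
qed (use assms(3) in auto)

lemma finite_permutes [simp]: "finite {p. p permutes {1..n::nat}}"
  by (simp add: finite_permutations)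

lemma finite_avoiders [simp]: "finite (avoiders n)"
  by (rule finite_subset[OF _ finite_permutes[of n]]) (auto simp: avoiders_def)

lemma finite_strong_avoiders [simp]: "finite (strong_avoiders n)"
  by (rule finite_subset[OF _ finite_permutes[of n]]) (auto simp: strong_avoiders_def)

lemma avoiding_involutions_subset_avoiders: "avoiding_involutions n \<subseteq> avoiders n"
  by (auto simp: avoiding_involutions_def)

lemma finite_avoiding_involutions [simp]: "finite (avoiding_involutions n)"
  by (rule finite_subset[OF avoiding_involutions_subset_avoiders finite_avoiders])

section \<open>Translations and cuts\<close>

text \<open>The main source of rigidity: counting up from the lower end and down from the upper end
  bounds \<open>f\<close> from both sides, because domain and range have the same length.\<close>

lemma increasing_eq_shift:
  fixes f :: "nat \<Rightarrow> nat"
  assumes inc: "\<And>x y. a < x \<Longrightarrow> x < y \<Longrightarrow> y \<le> a + k \<Longrightarrow> f x < f y"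
    and rng: "\<And>x. a < x \<Longrightarrow> x \<le> a + k \<Longrightarrow> b < f x \<and> f x \<le> b + k"
    and i: "1 \<le> i" "i \<le> k"
  shows "f (a + i) = b + i"
proof -
  have lo: "b + j \<le> f (a + j)" if "1 \<le> j" "j \<le> k" for j
    using that
  proof (induction j)
    case (Suc j)
    show ?case
    proof (cases "j = 0")
      case True then show ?thesis using rng[of "a + 1"] Suc.prems by auto
    next
      case False
      then show ?thesis using Suc.IH Suc.prems inc[of "a + j" "a + Suc j"] by auto
    qed
  qed simp
  have hi: "f (a + (k - j)) \<le> b + (k - j)" if "j < k" for j
    using that
  proof (induction j)
    case 0 then show ?case using rng[of "a + k"] by auto
  next
    case (Suc j)
    then have "f (a + (k - Suc j)) < f (a + (k - j))" using inc by auto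
    with Suc show ?case by auto
  qed
  show ?thesis using lo[OF i] hi[of "k - i"] i by auto
qed

text \<open>Pigeonhole: under each early entry there are \<open>n - h\<close> smaller values, and
  over each late entry \<open>h\<close> larger ones.\<close>

lemma dominance_cut:
  fixes h n x :: nat
  assumes p: "p permutes {1..n}" and h: "h \<le> n"
    and dom: "\<And>i j. 1 \<le> i \<Longrightarrow> i \<le> h \<Longrightarrow> h < j \<Longrightarrow> j \<le> n \<Longrightarrow> p j < p i"
    and x: "1 \<le> x" "x \<le> n"
  shows "x \<le> h \<longleftrightarrow> n - h < p x"
proof
  assume xh: "x \<le> h"
  have "p ` {h<..n} \<subseteq> {1..<p x}"
  proof
    fix v assume "v \<in> p ` {h<..n}"
    then obtain j where j: "h < j" "j \<le> n" "v = p j" by auto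
    from j(1) have "1 \<le> j" by linarith
    then show "v \<in> {1..<p x}" using j dom[of x j] x xh permutes_bounds(1)[OF p, of j] by simp
  qed
  then have "card (p ` {h<..n}) \<le> card {1..<p x}" by (intro card_mono) auto
  moreover have "card (p ` {h<..n}) = n - h"
    using permutes_inj_on[OF p] by (simp add: card_image)
  ultimately show "n - h < p x" using permutes_bounds[OF p x] by simp
next
  assume *: "n - h < p x"
  show "x \<le> h"
  proof (rule ccontr)
    assume "\<not> x \<le> h"
    then have "p ` {1..h} \<subseteq> {p x<..n}"
      using dom[of _ x] x h permutes_bounds[OF p] by auto
    then have "card (p ` {1..h}) \<le> card {p x<..n}" by (intro card_mono) auto
    moreover have "card (p ` {1..h}) = h"
      using permutes_inj_on[OF p] by (simp add: card_image)
    ultimately show False using * h permutes_bounds[OF p x]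
      unfolding card_greaterThanAtMost by linarith
  qed
qed

text \<open>An entry before the maximum that is smaller than an entry after it would form a 132 with
  the maximum in the middle.\<close>

lemma avoids132_before_max:
  assumes p: "p permutes {1..n}" "avoids132 n p" and k: "1 \<le> k" "k \<le> n" "p k = n"
    and x: "1 \<le> x" "x \<le> n"
  shows "x \<le> k \<longleftrightarrow> n - k < p x"
proof (rule dominance_cut[OF p(1) k(2) _ x])
  fix i j assume ij: "1 \<le> i" "i \<le> k" "k < j" "j \<le> n"
  have "p j \<noteq> n" using permutes_eq_iff[OF p(1), of j k] k ij by auto
  then have "p j < n" using permutes_bounds[OF p(1), of j] ij k by auto
  moreover have "p i \<noteq> p j" using permutes_eq_iff[OF p(1), of i j] ij by auto
  moreover have "\<not> p i < p j"
  proof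
    assume a: "p i < p j"
    then have "i \<noteq> k" using \<open>p j < n\<close> k by auto
    then show False using avoids132D[OF p(2), of i k j] ij a \<open>p j < n\<close> k by auto
  qed
  ultimately show "p j < p i" by auto
qed

text \<open>With the last entry as the 2 of the pattern, a value below \<open>p n\<close> cannot
  stand before one above it. So the values above \<open>p n\<close> occupy an initial segment, whose
  length is found by counting them.\<close>

lemma avoids132_above_last:
  assumes p: "p permutes {1..n}" "avoids132 n p" and x: "1 \<le> x" "x \<le> n"
  shows "x \<le> n - p n \<longleftrightarrow> p n < p x"
proof -
  have pn: "1 \<le> p n" "p n \<le> n" using permutes_bounds[OF p(1), of n] x by auto
  define A where "A = {y \<in> {1..n}. p n < p y}"
  have down: "y' \<in> A" if "y \<in> A" "1 \<le> y'" "y' < y" for y y'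
  proof (rule ccontr)
    assume "y' \<notin> A"
    then have "p y' \<le> p n" using that by (auto simp: A_def)
    moreover have "y' \<noteq> n" "y \<noteq> n" using that by (auto simp: A_def)
    ultimately have "p y' < p n" using permutes_eq_iff[OF p(1), of y' n] by auto
    then show False using avoids132D[OF p(2), of y' y n] that \<open>y \<noteq> n\<close> by (auto simp: A_def)
  qed
  have fA: "finite A" by (simp add: A_def)
  have "p ` A = {p n<..n}"
  proof
    show "p ` A \<subseteq> {p n<..n}" using permutes_bounds[OF p(1)] by (auto simp: A_def)
    show "{p n<..n} \<subseteq> p ` A"
    proof
      fix v assume "v \<in> {p n<..n}"
      then obtain y where "1 \<le> y" "y \<le> n" "p y = v" using permutes_preimage[OF p(1), of v] pn by auto
      then show "v \<in> p ` A" using \<open>v \<in> {p n<..n}\<close> by (auto simp: A_def)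
    qed
  qed
  then have cA: "card A = n - p n"
    using card_image[OF permutes_inj_on[OF p(1)], of A] by simp
  have "x \<in> A \<longleftrightarrow> x \<le> card A"
  proof
    assume "x \<in> A"
    then have "{1..x} \<subseteq> A" using down by (metis atLeastAtMost_iff le_neq_implies_less subsetI)
    then show "x \<le> card A" using card_mono[OF fA, of "{1..x}"] by simp
  next
    assume le: "x \<le> card A"
    show "x \<in> A"
    proof (rule ccontr)
      assume "x \<notin> A"
      have "A \<subseteq> {1..<x}"
      proof
        fix y assume "y \<in> A"
        then have "\<not> x < y" "x \<noteq> y" using down[of y x] x \<open>x \<notin> A\<close> by auto
        then show "y \<in> {1..<x}" using \<open>y \<in> A\<close> by (auto simp: A_def)
      qed
      then have "card A \<le> x - 1" using card_mono[of "{1..<x}" A] by simp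
      then show False using le x by simp
    qed
  qed
  then show ?thesis using x cA by (auto simp: A_def)
qed

text \<open>The pattern 132 is its own inverse: exchanging positions and values turns one occurrence
  into another.\<close>

lemma avoids132_inv:
  assumes p: "p permutes {1..n}" "avoids132 n p"
  shows "avoids132 n (inv p)"
proof (rule avoids132I)
  fix i j k assume *: "1 \<le> i" "i < j" "j < k" "k \<le> n" "inv p i < inv p k" "inv p k < inv p j"
  have ip: "inv p permutes {1..n}" by (rule permutes_inv[OF p(1)])
  have "p (inv p x) = x" for x using permutes_inverses[OF p(1)] by simp
  then show False
    using avoids132D[OF p(2), of "inv p i" "inv p k" "inv p j"] * permutes_bounds[OF ip, of i]
      permutes_bounds[OF ip, of j] by auto
qed

lemma strong_avoiders_inv: "p \<in> strong_avoiders n \<Longrightarrow> inv p \<in> strong_avoiders n"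
proof -
  assume "p \<in> strong_avoiders n"
  then have p: "p permutes {1..n}" "avoids132 n p" "avoids132 n (p \<circ> p)"
    by (auto simp: strong_avoiders_def strongly_avoids132_def)
  have "inv (p \<circ> p) = inv p \<circ> inv p"
    using permutes_bij[OF p(1)] by (simp add: o_inv_distrib)
  then show ?thesis
    using p avoids132_inv[OF p(1,2)] avoids132_inv[OF permutes_compose[OF p(1,1)] p(3)]
      permutes_inv[OF p(1)]
    by (auto simp: strong_avoiders_def strongly_avoids132_def)
qed

lemma avoiding_involutions_subset_strong_avoiders: "avoiding_involutions n \<subseteq> strong_avoiders n"
proof
  fix p assume "p \<in> avoiding_involutions n"
  then have p: "p permutes {1..n}" "avoids132 n p" "p \<circ> p = id"
    by (auto simp: avoiding_involutions_def avoiders_def)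
  have "avoids132 n id" by (rule avoids132I) auto
  with p show "p \<in> strong_avoiders n" by (auto simp: strong_avoiders_def strongly_avoids132_def)
qed

section \<open>Permutations whose maximum stands left of the final value\<close>

text \<open>
  With r = n - m, avoidance of 132 by p makes its graph decrease both across column k and across
  column r. Since p (p k) = m, avoidance by p \<circ> p makes p \<circ> p increasing wherever its value exceeds m,
  that is, on the positions of the values at most r. All the structure below comes from this.
\<close>
locale top_before_bottom =
  fixes n k m :: nat and p :: "nat \<Rightarrow> nat"
  assumes p_strong_avoiders: "p \<in> strong_avoiders n" and pk: "p k = n" and pn: "p n = m" and mn: "m < n" and km: "k \<le> m"
begin

lemma pp: "p permutes {1..n}" and av1: "avoids132 n p" and av2': "avoids132 n (p \<circ> p)"
  using p_strong_avoiders by (auto simp: strong_avoiders_def strongly_avoids132_def)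

lemma av2:
  assumes "1 \<le> i" "i < j" "j < l" "l \<le> n" "p (p i) < p (p l)" "p (p l) < p (p j)" shows False
  using avoids132D[OF av2' assms(1-4)] assms by simp

lemma k_pos: "1 \<le> k"
proof (rule ccontr)
  assume "\<not> 1 \<le> k"
  then have "p k = k" using pp by (auto simp: permutes_def)
  then show False using \<open>\<not> 1 \<le> k\<close> pk mn by auto
qed

lemma p_eq_iff [simp]: "p x = p y \<longleftrightarrow> x = y"
  by (rule permutes_eq_iff[OF pp])

lemma p_bounds:
  assumes "1 \<le> x" "x \<le> n" shows "1 \<le> p x" "p x \<le> n"
  using permutes_bounds[OF pp assms] .

lemma p2_bounds:
  assumes "1 \<le> x" "x \<le> n" shows "1 \<le> p (p x)" "p (p x) \<le> n"
  using p_bounds[OF p_bounds[OF assms]] .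

lemma preimage:
  assumes "1 \<le> y" "y \<le> n" obtains x where "1 \<le> x" "x \<le> n" "p x = y"
  using permutes_preimage[OF pp assms] .

lemma cut_k: "1 \<le> x \<Longrightarrow> x \<le> n \<Longrightarrow> x \<le> k \<longleftrightarrow> n - k < p x"
  using avoids132_before_max[OF pp av1 k_pos _ pk] km mn by auto

lemma cut_r: "1 \<le> x \<Longrightarrow> x \<le> n \<Longrightarrow> x \<le> n - m \<longleftrightarrow> m < p x"
  using avoids132_above_last[OF pp av1, of x] pn by simp

lemma k_le_r: "k \<le> n - m"
proof -
  have "\<not> n - k < p n" using cut_k[of n] km mn by simp
  then show ?thesis using pn km mn by simp
qed

lemma p2_le_m:
  assumes "1 \<le> i" "i \<le> k" shows "p (p i) \<le> m"
proof -
  have i: "i \<le> n" using assms km mn by simp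
  have "n - k < p i" using cut_k[OF assms(1) i] assms by simp
  then have "\<not> p i \<le> n - m" using km mn by simp
  then show ?thesis using cut_r[OF p_bounds[OF assms(1) i]] by simp
qed

lemma p2_k: "p (p k) = m"
  using pk pn by simp

text \<open>The index \<open>k\<close> acts as the 1 of the pattern: its value under
  \<open>p \<circ> p\<close> is \<open>m\<close>, and by \<open>p2_le_m\<close> every position with
  a larger value lies to its right, so a descent above \<open>m\<close> would complete a
  132.\<close>

lemma p2_incr_above_m:
  assumes "1 \<le> i" "i < j" "j \<le> n" "m < p (p i)" "m < p (p j)"
  shows "p (p i) < p (p j)"
proof (rule ccontr)
  assume *: "\<not> p (p i) < p (p j)"
  have "k < i" using p2_le_m[of i] assms by force
  moreover have "i \<noteq> j" using assms by simp
  then have "p (p j) < p (p i)" using * by (metis linorder_neqE_nat p_eq_iff)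
  ultimately show False using av2[of k i j] assms * k_pos p2_k by simp
qed

lemma p_le_r_iff:
  assumes "1 \<le> x" "x \<le> n" shows "p x \<le> n - m \<longleftrightarrow> m < p (p x)"
  using cut_r[OF p_bounds[OF assms]] .

lemma p2_incr:
  assumes "1 \<le> i" "i < j" "j \<le> n" "p i \<le> n - m" "p j \<le> n - m"
  shows "p (p i) < p (p j)"
  using p2_incr_above_m[of i j] p_le_r_iff assms by simp

text \<open>Here \<open>p \<circ> p\<close> is an increasing self-map of the positions after
  \<open>k\<close>, hence the identity there. The first \<open>k\<close> positions are sent by
  \<open>p\<close> among those, and injectivity carries the fixed points back.\<close>

lemma fixed_of_k_eq_m:
  assumes "k = m"
  shows "p (p x) = x"
proof (cases "1 \<le> x \<and> x \<le> n")
  case False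
  then have "p x = x" using pp by (auto simp: permutes_def)
  then show ?thesis by simp
next
  case True
  have km2: "2 * k \<le> n" using k_le_r assms mn by simp
  have hi: "k < p (p y)" if "k < y" "y \<le> n" for y
  proof -
    have "\<not> n - k < p y" using cut_k[of y] that by simp
    then show ?thesis using p_le_r_iff[of y] that assms by simp
  qed
  have top: "p (p y) = y" if y: "k < y" "y \<le> n" for y
  proof -
    have "(\<lambda>y. p (p y)) (k + (y - k)) = k + (y - k)"
    proof (rule increasing_eq_shift[where k = "n - k"])
      fix x y assume "k < x" "x < y" "y \<le> k + (n - k)"
      then show "p (p x) < p (p y)" using p2_incr_above_m[of x y] hi[of x] hi[of y] assms by simp
    next
      fix x assume "k < x" "x \<le> k + (n - k)"
      then show "k < p (p x) \<and> p (p x) \<le> k + (n - k)" using hi[of x] p2_bounds[of x] by simp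
    qed (use y in auto)
    then show ?thesis using y by simp
  qed
  show ?thesis
  proof (cases "k < x")
    case True with \<open>1 \<le> x \<and> x \<le> n\<close> show ?thesis using top by simp
  next
    case False
    then have "n - k < p x" using cut_k[of x] True by simp
    then have "p (p (p x)) = p x" using top[of "p x"] km2 p_bounds[of x] True by simp
    then show ?thesis by simp
  qed
qed

end

section \<open>The case k < m, seen from the maximum of the square\<close>

locale top_strictly_before_bottom = top_before_bottom +
  assumes k_less_m: "k < m"
begin

text \<open>The position of the maximum of \<open>p \<circ> p\<close>, as \<open>p q = k\<close> and
  \<open>p k = n\<close>. Comparing \<open>q\<close> with \<open>m\<close> separates the
  three-cycles (\<open>q = m\<close>) from the two kinds of rigid permutations.\<close>

definition q :: nat where "q = inv p k"

lemma pq: "p q = k"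
  unfolding q_def using permutes_inverses(1)[OF pp] .

lemma q_bounds: "1 \<le> q" "q < n"
proof -
  have "q \<in> {1..n}" unfolding q_def
    using permutes_in_image[OF permutes_inv[OF pp], of k] k_pos km mn by simp
  moreover have "q \<noteq> n" using pq pn k_less_m by auto
  ultimately show "1 \<le> q" "q < n" by auto
qed

lemma eq_q: "p x = k \<Longrightarrow> x = q"
  using pq p_eq_iff by metis

lemma p2_q: "p (p q) = n" by (simp add: pq pk)

lemma r_less_q: "n - m < q"
proof (rule ccontr)
  assume "\<not> n - m < q"
  then have "m < p q" using cut_r[of q] q_bounds by simp
  then show False using pq km by simp
qed

text \<open>The position \<open>q\<close> itself carries a value at most \<open>n - m\<close>, and
  \<open>p \<circ> p\<close> increases along such positions. Its maximum, attained at
  \<open>q\<close>, therefore comes last among them.\<close>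

lemma le_q:
  assumes "1 \<le> x" "x \<le> n" "p x \<le> n - m" shows "x \<le> q"
proof (rule ccontr)
  assume "\<not> x \<le> q"
  then have "p (p q) < p (p x)" using p2_incr[of q x] assms q_bounds pq k_le_r by simp
  then show False using p2_q p2_bounds[of x] assms by simp
qed

lemma cut2: "1 \<le> x \<Longrightarrow> x \<le> n \<Longrightarrow> x \<le> q \<longleftrightarrow> n - q < p (p x)"
  using avoids132_before_max[OF permutes_compose[OF pp pp] av2', of q x] q_bounds p2_q by simp

lemma r_less_p:
  assumes "q < x" "x \<le> n" shows "n - m < p x"
  using le_q[of x] assms by force

text \<open>By \<open>le_q\<close> the value 1 stands no later than \<open>q\<close>, and it would
  complete any descent after \<open>q\<close> to a 132.\<close>

lemma p_incr:
  assumes "q < i" "i < j" "j \<le> n" shows "p i < p j"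
proof (rule ccontr)
  assume *: "\<not> p i < p j"
  obtain x where x: "1 \<le> x" "x \<le> n" "p x = 1" using preimage[of 1] mn by auto
  have "x \<le> q" using le_q[of x] x mn by simp
  moreover have "1 < p j" using r_less_p[of j] assms mn by simp
  moreover have "i \<noteq> j" using assms by simp
  then have "p j < p i" using * by (metis linorder_neqE_nat p_eq_iff)
  ultimately show False using avoids132D[OF av1, of x i j] assms * x by simp
qed

lemma p_le_m:
  assumes "q < x" "x \<le> n" shows "p x \<le> m"
  using cut_r[of x] assms r_less_q by simp

lemma le_t_iff: 
  assumes "1 \<le> x" "x \<le> n" shows "p (p x) \<le> n - q \<longleftrightarrow> q < x"
  using cut2[OF assms] by auto

lemma preimage_t:
  assumes "1 \<le> y" "y \<le> n" "p y \<le> n - q"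
  obtains x where "q < x" "x \<le> n" "p x = y"
proof -
  obtain x where "1 \<le> x" "x \<le> n" "p x = y" using preimage assms by blast
  then show ?thesis using that le_t_iff[of x] assms by auto
qed

text \<open>Take the entry \<open>k\<close> at position \<open>q\<close> as the 2 of the pattern: up
  to \<open>q\<close>, no larger value can follow a value below \<open>k\<close>. By
  \<open>le_q\<close> all values up to \<open>k\<close> occur there, so they fill the last
  \<open>k\<close> of these positions.\<close>

lemma le_k_iff:
  assumes "1 \<le> x" "x \<le> n" shows "p x \<le> k \<longleftrightarrow> q - k < x \<and> x \<le> q"
proof -
  define I where "I = {x \<in> {1..n}. p x \<le> k}"
  have Iq: "I \<subseteq> {1..q}" using le_q k_le_r by (auto simp: I_def)
  have up: "y \<in> I" if "x \<in> I" "x < y" "y \<le> q" for x y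
  proof (rule ccontr)
    assume "y \<notin> I"
    then have "k < p y" "1 \<le> x" using that q_bounds by (auto simp: I_def)
    moreover have "p x \<noteq> k" using eq_q that by force
    moreover have "y \<noteq> q" using \<open>k < p y\<close> pq by auto
    ultimately show False
      using avoids132D[OF av1, of x y q] that q_bounds pq by (auto simp: I_def)
  qed
  have "p ` I = {1..k}"
  proof
    show "p ` I \<subseteq> {1..k}" using p_bounds by (auto simp: I_def)
    show "{1..k} \<subseteq> p ` I"
    proof
      fix v assume v: "v \<in> {1..k}"
      then obtain x where "1 \<le> x" "x \<le> n" "p x = v" using preimage[of v] km mn by auto
      then show "v \<in> p ` I" using v by (auto simp: I_def)
    qed
  qed
  then have cI: "card I = k" using card_image[OF permutes_inj_on[OF pp], of I] by simp
  have fI: "finite I" by (simp add: I_def)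
  have "x \<in> I \<longleftrightarrow> q - k < x \<and> x \<le> q"
  proof
    assume xI: "x \<in> I"
    then have "x \<le> q" using Iq by auto
    have "{x..q} \<subseteq> I"
    proof
      fix y assume "y \<in> {x..q}"
      then show "y \<in> I" using up[OF xI, of y] xI by (cases "y = x") auto
    qed
    then have "card {x..q} \<le> k" using card_mono[OF fI] cI by metis
    then show "q - k < x \<and> x \<le> q" using \<open>x \<le> q\<close> assms by auto
  next
    assume x: "q - k < x \<and> x \<le> q"
    show "x \<in> I"
    proof (rule ccontr)
      assume xI: "x \<notin> I"
      have "I \<subseteq> {x<..q}"
      proof
        fix y assume "y \<in> I"
        then show "y \<in> {x<..q}" using up[of y x] x xI Iq by (cases y x rule: linorder_cases) auto
      qed
      then have "card I \<le> card {x<..q}" by (intro card_mono) auto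
      then show False using cI x by (simp; linarith)
    qed
  qed
  then show ?thesis using assms by (simp add: I_def)
qed

lemma r_plus_k_le_q: "n - m + k \<le> q"
proof -
  have "k < q" using r_less_q k_le_r by simp
  then have *: "1 \<le> q - k + 1" "q - k + 1 \<le> n" using q_bounds k_pos by auto
  have "p (q - k + 1) \<le> k" using le_k_iff[OF *] k_pos \<open>k < q\<close> by simp
  then have "\<not> m < p (q - k + 1)" using km by simp
  then have "\<not> q - k + 1 \<le> n - m" using cut_r[OF *] by simp
  then show ?thesis using \<open>k < q\<close> by simp
qed

end

section \<open>Removing three-cycles\<close>

text \<open>Top skew blocks of p that lie above the value p n; their number is the statistic that keeps track of
  the possible positions at which a removed three-cycle block can be reinserted.\<close>
definition cuts :: "nat \<Rightarrow> (nat \<Rightarrow> nat) \<Rightarrow> nat set" where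
  "cuts n p = {h. 1 \<le> h \<and> h \<le> n - p n \<and> (\<forall>x. 1 \<le> x \<longrightarrow> x \<le> n \<longrightarrow> (x \<le> h \<longleftrightarrow> n - h < p x))}"

definition three_cycles :: "nat \<Rightarrow> (nat \<Rightarrow> nat) set" where
  "three_cycles n = {p \<in> strong_avoiders n. p n < n \<and> p (p n) < p n \<and> p (p (p n)) = n}"

text \<open>If p cycles [1,k] to (n-k,n] to (m-k,m] to [1,k], then emb k m enumerates the positions outside
  these blocks, prj k m is its inverse, and peel is the pattern of p there.\<close>
definition emb :: "nat \<Rightarrow> nat \<Rightarrow> nat \<Rightarrow> nat" where
  "emb k m x = (if x \<le> m - 2 * k then x + k else x + 2 * k)"

definition prj :: "nat \<Rightarrow> nat \<Rightarrow> nat \<Rightarrow> nat" where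
  "prj k m y = (if y \<le> m then y - k else y - 2 * k)"

definition peel :: "nat \<Rightarrow> nat \<Rightarrow> nat \<Rightarrow> (nat \<Rightarrow> nat) \<Rightarrow> nat \<Rightarrow> nat" where
  "peel n k m p x = (if 1 \<le> x \<and> x \<le> n - 3 * k then prj k m (p (emb k m x)) else x)"

text \<open>The pattern of the entries in front of the maximum. In a three-cycle block it is the
  only free datum: the last third is translated, and the middle third is then forced because
  \<open>p \<circ> p\<close> translates it.\<close>

definition head :: "nat \<Rightarrow> nat \<Rightarrow> (nat \<Rightarrow> nat) \<Rightarrow> nat \<Rightarrow> nat" where
  "head n k p x = (if 1 \<le> x \<and> x < k then p x - (n - k) else x)"

lemma emb_strict_mono: "x < y \<Longrightarrow> emb k m x < emb k m y"
  by (auto simp: emb_def)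

lemma emb_eq_iff: "emb k m x = emb k m y \<longleftrightarrow> x = y"
  by (metis emb_strict_mono linorder_neqE_nat less_irrefl)

lemma emb_less_iff: "emb k m x < emb k m y \<longleftrightarrow> x < y"
  by (metis emb_strict_mono linorder_neqE_nat less_asym less_irrefl)

context top_before_bottom
begin

lemma head_avoiders: "head n k p \<in> avoiders (k - 1)"
proof -
  have rng: "n - k < p x \<and> p x < n" if "1 \<le> x" "x < k" for x
  proof -
    have "p x \<noteq> p k" using that by simp
    then have "p x \<noteq> n" using pk by metis
    then show ?thesis using cut_k[of x] p_bounds[of x] that km mn by simp
  qed
  have "head n k p permutes {1..k - 1}"
  proof (rule permutes_atLeastAtMostI)
    fix x assume "1 \<le> x" "x \<le> k - 1"
    then show "1 \<le> head n k p x \<and> head n k p x \<le> k - 1"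
      using rng[of x] km mn by (auto simp: head_def)
  next
    fix x y assume "1 \<le> x" "x < y" "y \<le> k - 1"
    moreover from this have "p x \<noteq> p y" by simp
    ultimately show "head n k p x \<noteq> head n k p y"
      using rng[of x] rng[of y] eq_diff_iff[of "n - k" "p x" "p y"] by (auto simp: head_def)
  qed (auto simp: head_def)
  moreover have "avoids132 (k - 1) (head n k p)"
  proof (rule avoids132I)
    fix i j l assume *: "1 \<le> i" "i < j" "j < l" "l \<le> k - 1"
      "head n k p i < head n k p l" "head n k p l < head n k p j"
    then have "head n k p i = p i - (n - k)" "head n k p j = p j - (n - k)" "head n k p l = p l - (n - k)"
      by (auto simp: head_def)
    then have "p i < p l" "p l < p j" using * by linarith+
    moreover have "l \<le> n" using * km mn by linarith
    ultimately show False using avoids132D[OF av1, of i j l] * by blast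
  qed
  ultimately show ?thesis by (simp add: avoiders_def)
qed

end

section \<open>Structure of a three-cycle block\<close>

locale three_cycle = top_strictly_before_bottom +
  assumes pm: "p m = k"
begin

lemma q_eq: "q = m"
  using eq_q[OF pm] by simp

lemma k2_le_m: "n - m + k \<le> m" "2 * k \<le> m"
  using r_plus_k_le_q q_eq k_le_r by auto

text \<open>p \<circ> p \<circ> p is an increasing self-map of the last n - m positions, hence the identity there.\<close>
lemma p3:
  assumes x: "m < x" "x \<le> n" shows "p (p (p x)) = x"
proof -
  have le: "p (p y) \<le> n - m" if "m < y" "y \<le> n" for y
    using le_t_iff[of y] that q_eq by simp
  have "(\<lambda>y. p (p (p y))) (m + (x - m)) = m + (x - m)"
  proof (rule increasing_eq_shift[where k = "n - m"])
    fix x y assume xy: "m < x" "x < y" "y \<le> m + (n - m)"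
    then show "p (p (p x)) < p (p (p y))"
      using p2_incr[of "p x" "p y"] le[of x] le[of y] p_incr[of x y] p_bounds[of x] p_bounds[of y] q_eq
      by simp
  next
    fix x assume "m < x" "x \<le> m + (n - m)"
    then show "m < p (p (p x)) \<and> p (p (p x)) \<le> m + (n - m)"
      using le[of x] p_le_r_iff[of "p x"] p_bounds[of x] p2_bounds[of "p x"] by simp
  qed (use x in auto)
  then show ?thesis using x by simp
qed

text \<open>Since \<open>p3\<close> returns \<open>x\<close> to its place beyond
  \<open>n - k\<close>, the value \<open>p (p x)\<close> is at most \<open>k\<close>. By
  \<open>le_k_iff\<close> this puts \<open>p x\<close> among the last \<open>k\<close> positions up
  to \<open>q = m\<close>, and monotonicity after \<open>q\<close> leaves only the
  translation.\<close>

lemma p_last: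
  assumes "1 \<le> i" "i \<le> k" shows "p (n - k + i) = m - k + i"
proof (rule increasing_eq_shift[where k = k, OF _ _ assms])
  fix x y assume "n - k < x" "x < y" "y \<le> n - k + k"
  then show "p x < p y" using p_incr[of x y] q_eq k_le_r by simp
next
  fix x assume x: "n - k < x" "x \<le> n - k + k"
  then have x': "m < x" "x \<le> n" "1 \<le> x" using k_le_r mn km by auto
  have "p (p (p x)) = x" using p3 x' by simp
  then have "p (p x) \<le> k" using cut_k[of "p (p x)"] p2_bounds[of x] x' x by simp
  then show "m - k < p x \<and> p x \<le> m - k + k"
    using le_k_iff[of "p x"] p_bounds[of x] x' q_eq km by simp
qed

lemma p2_middle:
  assumes "1 \<le> i" "i \<le> k" shows "p (p (m - k + i)) = n - k + i"
  using p3[of "n - k + i"] p_last[OF assms] k_le_r assms mn km by simp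

definition S :: "nat set" where "S = {k<..m - k} \<union> {m<..n - k}"

lemma S_iff: "y \<in> S \<longleftrightarrow> 1 \<le> y \<and> y \<le> n \<and> \<not> y \<le> k \<and> \<not> (m - k < y \<and> y \<le> m) \<and> \<not> n - k < y"
  using k2_le_m k_le_r mn k_pos by (auto simp: S_def)

text \<open>Each removed block is the full image of another removed block, so no outside position
  can be mapped into one.\<close>

lemma p_S: assumes "y \<in> S" shows "p y \<in> S"
proof -
  have y: "1 \<le> y" "y \<le> n" using assms S_iff by auto
  have "\<not> p y \<le> k" using le_k_iff[OF y] assms q_eq S_iff by simp
  moreover have "\<not> n - k < p y" using cut_k[OF y] assms S_iff by simp
  moreover have "\<not> (m - k < p y \<and> p y \<le> m)"
  proof
    assume *: "m - k < p y \<and> p y \<le> m"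
    define i where "i = p y - (m - k)"
    have i: "1 \<le> i" "i \<le> k" "p y = m - k + i" using * km by (auto simp: i_def)
    then have "p y = p (n - k + i)" using p_last by simp
    then have "y = n - k + i" by simp
    then show False using assms S_iff i by simp
  qed
  ultimately show ?thesis using p_bounds[OF y] S_iff by blast
qed

lemma emb_S: "1 \<le> x \<Longrightarrow> x \<le> n - 3 * k \<Longrightarrow> emb k m x \<in> S"
  using k2_le_m k_le_r mn by (auto simp: S_def emb_def)

lemma emb_prj: "y \<in> S \<Longrightarrow> emb k m (prj k m y) = y"
  using k2_le_m k_le_r mn by (auto simp: S_def emb_def prj_def)

lemma prj_bounds: "y \<in> S \<Longrightarrow> 1 \<le> prj k m y" "y \<in> S \<Longrightarrow> prj k m y \<le> n - 3 * k"
  using k2_le_m k_le_r mn by (auto simp: S_def prj_def)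

abbreviation "N \<equiv> n - 3 * k"
abbreviation "t \<equiv> peel n k m p"

lemma emb_peel:
  assumes "1 \<le> x" "x \<le> N" shows "emb k m (t x) = p (emb k m x)"
  using assms emb_prj[OF p_S[OF emb_S[OF assms]]] by (simp add: peel_def)

lemma peel_bounds: 
  assumes "1 \<le> x" "x \<le> N" shows "1 \<le> t x" "t x \<le> N"
  using assms prj_bounds[OF p_S[OF emb_S[OF assms]]] by (simp_all add: peel_def)

lemma emb_peel2:
  assumes "1 \<le> x" "x \<le> N" shows "emb k m (t (t x)) = p (p (emb k m x))"
  using emb_peel[OF assms] emb_peel[OF peel_bounds[OF assms]] by simp

lemma emb_bounds: 
  assumes "1 \<le> x" "x \<le> N" shows "1 \<le> emb k m x" "emb k m x \<le> n"
  using emb_S[OF assms] S_iff by auto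

lemma peel_strong_avoiders: "t \<in> strong_avoiders N"
proof -
  have "t permutes {1..N}"
  proof (rule permutes_atLeastAtMostI)
    fix x y assume *: "1 \<le> x" "x < y" "y \<le> N"
    then have "p (emb k m x) \<noteq> p (emb k m y)" using emb_strict_mono[of x y k m] by simp
    then show "t x \<noteq> t y" using emb_peel[of x] emb_peel[of y] * by auto
  qed (use peel_bounds in \<open>auto simp: peel_def\<close>)
  moreover have "avoids132 N t"
  proof (rule avoids132I)
    fix i j l assume *: "1 \<le> i" "i < j" "j < l" "l \<le> N" "t i < t l" "t l < t j"
    then have "p (emb k m i) < p (emb k m l)" "p (emb k m l) < p (emb k m j)"
      using emb_strict_mono[of "t i" "t l" k m] emb_strict_mono[of "t l" "t j" k m] emb_peel[of i]
       emb_peel[of j] emb_peel[of l] by auto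
    then show False
      using * avoids132D[OF av1, of "emb k m i" "emb k m j" "emb k m l"] emb_bounds[of i] emb_bounds[of l]
        emb_strict_mono by simp
  qed
  moreover have "avoids132 N (t \<circ> t)"
  proof (rule avoids132I)
    fix i j l assume *: "1 \<le> i" "i < j" "j < l" "l \<le> N" "(t \<circ> t) i < (t \<circ> t) l" "(t \<circ> t) l < (t \<circ> t) j"
    then have "p (p (emb k m i)) < p (p (emb k m l))" "p (p (emb k m l)) < p (p (emb k m j))"
      using emb_strict_mono[of "t (t i)" "t (t l)" k m] emb_strict_mono[of "t (t l)" "t (t j)" k m]
        emb_peel2[of i] emb_peel2[of j] emb_peel2[of l] by auto
    then show False
      using * av2[of "emb k m i" "emb k m j" "emb k m l"] emb_bounds[of i] emb_bounds[of l]
        emb_strict_mono by simp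
  qed
  ultimately show ?thesis by (simp add: strong_avoiders_def strongly_avoids132_def)
qed

text \<open>If \<open>k < n - m\<close>, position \<open>n - k\<close> survives as the last point of
  the pattern, and \<open>p3\<close> keeps it on a cycle of length three. The cut of
  \<open>p\<close> after column \<open>n - m\<close> descends to the cut \<open>n - m - k\<close>,
  from which the lost parameter \<open>m\<close> can be recovered.\<close>

lemma peel_three_cycles:
  assumes r: "k < n - m"
  shows "t \<in> three_cycles N" "n - m - k \<in> cuts N t"
proof -
  have N: "1 \<le> N" "N \<le> N" "\<not> N \<le> m - 2 * k" using k2_le_m r by auto
  have eN: "emb k m N = n - k" using N k2_le_m r by (auto simp: emb_def)
  have nk: "n - k \<in> S" using emb_S[OF N(1,2)] eN by simp
  let ?a = "p (n - k)" let ?b = "p ?a"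
  have eb: "emb k m (t N) = ?a" "emb k m (t (t N)) = ?b"
    using emb_peel[OF N(1,2)] emb_peel2[OF N(1,2)] eN by auto
  have "?a < m - k + 1"
    using p_incr[of "n - k" "n - k + 1"] p_last[of 1] q_eq r k_pos by simp
  then have a: "?a \<le> m - k" by simp
  have p3: "p ?b = n - k" using p3[of "n - k"] r by simp
  have "n - m < ?a" using r_less_p[of "n - k"] q_eq r by simp
  have "?b \<le> n - m" using cut_r[of ?b] p3 r p2_bounds[of "n - k"] k_pos by simp
  then have "emb k m (t (t N)) < emb k m (t N)" using eb \<open>n - m < ?a\<close> by simp
  then have ba: "t (t N) < t N" using emb_less_iff by blast
  have tb: "1 \<le> t N" "t N \<le> N" "1 \<le> t (t N)" "t (t N) \<le> N" using peel_bounds N by auto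
  have "?a < n - k" using a r by simp
  then have "emb k m (t N) < emb k m N" using eb eN by simp
  then have aN: "t N < N" using emb_less_iff by blast
  have "emb k m (t (t (t N))) = emb k m N" using emb_peel[of "t (t N)"] tb eb p3 eN by simp
  then have "t (t (t N)) = N" by (simp add: emb_eq_iff)
  then show "t \<in> three_cycles N" using ba aN peel_strong_avoiders by (simp add: three_cycles_def)
  have "t N = ?a - k" using N eN a by (simp add: peel_def prj_def)
  then have h: "n - m - k \<le> N - t N" using a k2_le_m r by linarith
  have "x \<le> n - m - k \<longleftrightarrow> N - (n - m - k) < t x" if x: "1 \<le> x" "x \<le> N" for x
  proof -
    have NN: "N - (n - m - k) = m - 2 * k" using r k2_le_m by simp
    have S: "p (emb k m x) \<in> S" using p_S[OF emb_S[OF x]] .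
    have "t x = prj k m (p (emb k m x))" using x by (simp add: peel_def)
    then have "m - 2 * k < t x \<longleftrightarrow> m < p (emb k m x)"
      using S k2_le_m by (auto simp: S_def prj_def)
    also have "\<dots> \<longleftrightarrow> emb k m x \<le> n - m" using cut_r[OF emb_bounds[OF x]] by simp
    also have "\<dots> \<longleftrightarrow> x \<le> n - m - k" using k2_le_m r by (auto simp: emb_def)
    finally show ?thesis using NN by simp
  qed
  moreover have "1 \<le> n - m - k" using r by linarith
  ultimately show "n - m - k \<in> cuts N t" using h unfolding cuts_def by blast
qed

text \<open>Every cut of \<open>p\<close> contains position \<open>k\<close>, where the maximum
  stands. A larger one loses exactly the first \<open>k\<close> positions, and it stays within the
  first \<open>n - m\<close> columns. Thus reinsertion keeps only the cuts up to the chosen one and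
  adds one more.\<close>

lemma cuts_peel:
  "cuts n p \<subseteq> insert k ((\<lambda>h. h + k) ` {h \<in> cuts N t. h \<le> n - m - k})"
proof
  fix h assume "h \<in> cuts n p"
  then have h: "1 \<le> h" "h \<le> n - m" and
    cut: "\<And>x. 1 \<le> x \<Longrightarrow> x \<le> n \<Longrightarrow> x \<le> h \<longleftrightarrow> n - h < p x"
    by (auto simp: cuts_def pn)
  have "k \<le> h" using cut[of k] pk h k_pos km mn by simp
  show "h \<in> insert k ((\<lambda>h. h + k) ` {h \<in> cuts N t. h \<le> n - m - k})"
  proof (cases "h = k")
    case False
    then have hk: "k < h" using \<open>k \<le> h\<close> by simp
    then have r: "k < n - m" using h by simp
    have c: "x \<le> h - k \<longleftrightarrow> N - (h - k) < t x" if x: "1 \<le> x" "x \<le> N" for x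
    proof -
      have NN: "N - (h - k) = n - 2 * k - h" using hk h k2_le_m by simp
      have S: "p (emb k m x) \<in> S" using p_S[OF emb_S[OF x]] .
      have "t x = prj k m (p (emb k m x))" using x by (simp add: peel_def)
      then have "n - 2 * k - h < t x \<longleftrightarrow> n - h < p (emb k m x)"
        using S k2_le_m h mn by (auto simp: S_def prj_def)
      also have "\<dots> \<longleftrightarrow> emb k m x \<le> h" using cut[OF emb_bounds[OF x]] by simp
      also have "\<dots> \<longleftrightarrow> x \<le> h - k" using k2_le_m h hk by (auto simp: emb_def)
      finally show ?thesis using NN by simp
    qed
    have "n - m - k \<le> N - t N" using peel_three_cycles(2)[OF r] by (simp add: cuts_def)
    then have "h - k \<le> N - t N" using h by linarith
    moreover have "1 \<le> h - k" using hk by linarith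
    ultimately have "h - k \<in> cuts N t" using c unfolding cuts_def by blast
    moreover have "h = (h - k) + k" using hk by simp
    ultimately show ?thesis using h by (intro insertI2 image_eqI[of _ _ "h - k"]) auto
  qed simp
qed

end

text \<open>The delicate part is the middle block. There \<open>p \<circ> p\<close> is a translation
  and \<open>p\<close> lands in the first block, where both permutations already agree by
  \<open>head\<close>; injectivity then gives equality.\<close>

lemma three_cycle_eqI:
  assumes "three_cycle n k m p" "three_cycle n k m p'"
    and head: "head n k p = head n k p'" and peel: "peel n k m p = peel n k m p'"
  shows "p = p'"
proof
  interpret A: three_cycle n k m p by fact
  interpret B: three_cycle n k m p' by fact
  have low: "p x = p' x" if "1 \<le> x" "x \<le> k" for x
  proof (cases "x = k")
    case True then show ?thesis using A.pk B.pk by simp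
  next
    case False
    then have "p x - (n - k) = p' x - (n - k)"
      using fun_cong[OF head, of x] that by (simp add: head_def)
    then show ?thesis using A.cut_k[of x] B.cut_k[of x] that A.km A.mn by simp
  qed
  fix x
  consider "x = 0 \<or> n < x" | "1 \<le> x" "x \<le> k" | "n - k < x" "x \<le> n" | "m - k < x" "x \<le> m" | "x \<in> A.S"
    using A.S_iff[of x] by force
  then show "p x = p' x"
  proof cases
    case 1 then show ?thesis using A.pp B.pp by (auto simp: permutes_def)
  next
    case 2 then show ?thesis by (rule low)
  next
    case 3
    then show ?thesis using A.p_last[of "x - (n - k)"] B.p_last[of "x - (n - k)"] by simp
  next
    case 4
    then have *: "p (p x) = p' (p' x)"
      using A.p2_middle[of "x - (m - k)"] B.p2_middle[of "x - (m - k)"] by simp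
    have "1 \<le> x" "x \<le> n" using 4 A.mn by auto
    then have "1 \<le> p x" "p x \<le> k"
      using A.p_bounds[of x] A.le_k_iff[of x] 4 A.q_eq by auto
    then have "p' (p x) = p' (p' x)" using low[of "p x"] * by simp
    then show ?thesis by simp
  next
    case 5
    define y where "y = prj k m x"
    have y: "1 \<le> y" "y \<le> n - 3 * k" "emb k m y = x"
      using A.prj_bounds[OF 5] A.emb_prj[OF 5] by (auto simp: y_def)
    have "p x = emb k m (peel n k m p y)" using A.emb_peel[OF y(1,2)] y(3) by simp
    also have "\<dots> = p' x" unfolding peel using B.emb_peel[OF y(1,2)] y(3) by simp
    finally show ?thesis .
  qed
qed

section \<open>The rigid permutations\<close>

text \<open>
  Permutations determined by a 132-avoider of size s, namely the block of p on (r,r+s]. They occur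
  with 3 * s < n, so there are only about 4 powr (n / 3) of them.
\<close>
definition rigid :: "nat \<Rightarrow> nat \<Rightarrow> nat \<Rightarrow> (nat \<Rightarrow> nat) set" where
  "rigid n r s = {p. p permutes {1..n} \<and> r + s \<le> n \<and>
      (\<forall>x. 1 \<le> x \<longrightarrow> x \<le> r \<longrightarrow> n - r < p x) \<and>
      (\<lambda>i. if 1 \<le> i \<and> i \<le> s then p (r + i) else i) \<in> avoiders s \<and>
      (\<forall>i. 1 \<le> i \<longrightarrow> i \<le> n - r - s \<longrightarrow> p (r + s + i) = s + i) \<and>
      (\<forall>i. 1 \<le> i \<longrightarrow> i \<le> r \<longrightarrow> p (p (r + i)) = n - r + i)}"

context top_strictly_before_bottom
begin

lemma block_avoiders:
  assumes "r + s \<le> n" and le: "\<And>i. 1 \<le> i \<Longrightarrow> i \<le> s \<Longrightarrow> p (r + i) \<le> s"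
  shows "(\<lambda>i. if 1 \<le> i \<and> i \<le> s then p (r + i) else i) \<in> avoiders s" (is "?f \<in> _")
proof -
  have "?f permutes {1..s}"
    by (rule permutes_atLeastAtMostI) (use le p_bounds(1) assms(1) in auto)
  moreover have "avoids132 s ?f"
  proof (rule avoids132I)
    fix i j l assume *: "1 \<le> i" "i < j" "j < l" "l \<le> s" "?f i < ?f l" "?f l < ?f j"
    then have "p (r + i) < p (r + l)" "p (r + l) < p (r + j)" by auto
    then show False using avoids132D[OF av1, of "r + i" "r + j" "r + l"] * assms(1) by simp
  qed
  ultimately show ?thesis by (simp add: avoiders_def)
qed

text \<open>Counting shows that the positions of values up to \<open>n - q\<close> are those of
  values up to \<open>n - m\<close> together with the positions from \<open>q + 1\<close> to
  \<open>m\<close>. Then \<open>n - m + 1\<close> stands at \<open>q + 1\<close> and serves as the 2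
  of a 132, which forces the values up to \<open>n - m\<close> to fill the positions from
  \<open>n - m + 1\<close> to \<open>q\<close>. Hence \<open>q = 2 * (n - m)\<close>, and the rest
  consists of translations.\<close>

lemma rigid_small_q:
  assumes qm: "q < m"
  shows "p \<in> rigid n (n - m) (n - m)" "3 * (n - m) < n"
proof -
  let ?r = "n - m" and ?t = "n - q"
  have rt: "?r < ?t" using qm mn by simp
  have pm_le: "p m \<le> ?t" using le_t_iff[of n] pn q_bounds by simp
  have mid_le: "p x \<le> ?t" if "q < x" "x \<le> m" for x
    using p_incr[of x m] that mn pm_le by (cases "x = m") auto
  define A where "A = {y \<in> {1..n}. p y \<le> ?t}"
  define P where "P = {y \<in> {1..n}. p y \<le> ?r}"
  have img: "p ` {y \<in> {1..n}. p y \<le> v} = {1..v}" if "v \<le> n" for v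
  proof
    show "p ` {y \<in> {1..n}. p y \<le> v} \<subseteq> {1..v}" using p_bounds by auto
    show "{1..v} \<subseteq> p ` {y \<in> {1..n}. p y \<le> v}"
    proof
      fix w assume w: "w \<in> {1..v}"
      then have "1 \<le> w" "w \<le> n" using that by auto
      then obtain x where "1 \<le> x" "x \<le> n" "p x = w" using preimage by blast
      then show "w \<in> p ` {y \<in> {1..n}. p y \<le> v}" using w by auto
    qed
  qed
  have cA: "card A = ?t" and cP: "card P = ?r"
    using card_image[OF permutes_inj_on[OF pp], of A] card_image[OF permutes_inj_on[OF pp], of P]
      img[of ?t] img[of ?r] by (auto simp: A_def P_def)
  have "1 \<le> x \<and> x \<le> n \<and> p x \<le> ?t" if "q < x" "x \<le> m" for x
    using mid_le[OF that] that mn by linarith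
  then have PA: "P \<union> {q<..m} \<subseteq> A" using rt by (auto simp: A_def P_def)
  have "P \<inter> {q<..m} = {}" using le_q by (force simp: P_def)
  then have "card (P \<union> {q<..m}) = ?r + (m - q)"
    using cP by (subst card_Un_disjoint) (auto simp: P_def)
  then have "card (P \<union> {q<..m}) = card A" using cA qm mn by simp
  then have A_eq: "A = P \<union> {q<..m}"
    using card_subset_eq[OF _ PA] by (simp add: A_def)
  have le_r: "p y \<le> ?r" if "1 \<le> y" "y \<le> q" "p y \<le> ?t" for y
  proof -
    have "y \<in> A" using that q_bounds by (simp add: A_def)
    then show ?thesis using A_eq that by (auto simp: P_def)
  qed
  have shift1: "p (q + i) = ?r + i" if "1 \<le> i" "i \<le> m - q" for i
  proof (rule increasing_eq_shift[OF _ _ that])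
    fix x y assume "q < x" "x < y" "y \<le> q + (m - q)"
    then show "p x < p y" using p_incr qm mn by simp
  next
    fix x assume "q < x" "x \<le> q + (m - q)"
    then show "?r < p x \<and> p x \<le> ?r + (m - q)" using r_less_p[of x] mid_le[of x] qm mn by simp
  qed
  have "p (?r + 1) \<le> ?t"
  proof -
    have "p (p (q + 1)) \<le> ?t" using le_t_iff[of "q + 1"] q_bounds by simp
    then show ?thesis using shift1[of 1] qm by simp
  qed
  then have r1_le: "p (?r + 1) \<le> ?r" using le_r[of "?r + 1"] r_less_q by simp
  have P_iff: "p x \<le> ?r \<longleftrightarrow> ?r < x \<and> x \<le> q" if x: "1 \<le> x" "x \<le> n" for x
  proof
    assume *: "p x \<le> ?r"
    have "\<not> x \<le> ?r" using cut_r[OF x] * r_less_q qm by simp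
    then show "?r < x \<and> x \<le> q" using le_q[OF x *] by simp
  next
    assume *: "?r < x \<and> x \<le> q"
    show "p x \<le> ?r"
    proof (rule ccontr)
      assume a: "\<not> p x \<le> ?r"
      then have "?r + 1 < x" using * r1_le by (cases "x = ?r + 1") auto
      have b: "p (q + 1) = ?r + 1" using shift1[of 1] qm by simp
      have "x \<noteq> q + 1" using * by simp
      then have "p x \<noteq> ?r + 1" using b p_eq_iff by metis
      then have "p (q + 1) < p x" using a b by simp
      then show False
        using avoids132D[OF av1, of "?r + 1" x "q + 1"] * \<open>?r + 1 < x\<close> b r1_le qm mn by simp
    qed
  qed
  have "P = {?r<..q}" using P_iff q_bounds by (auto simp: P_def)
  then have q2: "q = 2 * ?r" using cP r_less_q by simp
  show small: "3 * (n - m) < n" using q2 qm mn by simp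
  have shift2: "p (q + i) = ?r + i" if "1 \<le> i" "i \<le> n - q" for i
  proof (rule increasing_eq_shift[OF _ _ that])
    fix x y assume "q < x" "x < y" "y \<le> q + (n - q)"
    then show "p x < p y" using p_incr q_bounds by simp
  next
    fix x assume "q < x" "x \<le> q + (n - q)"
    then show "?r < p x \<and> p x \<le> ?r + (n - q)" using r_less_p[of x] p_le_m[of x] q2 mn small by simp
  qed
  have shift3: "(\<lambda>x. p (p x)) (?r + i) = m + i" if "1 \<le> i" "i \<le> ?r" for i
  proof (rule increasing_eq_shift[OF _ _ that])
    fix x y assume "?r < x" "x < y" "y \<le> ?r + ?r"
    then show "p (p x) < p (p y)" using p2_incr[of x y] P_iff[of x] P_iff[of y] q2 small by simp
  next
    fix x assume x: "?r < x" "x \<le> ?r + ?r"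
    then have "p x \<le> ?r" using P_iff[of x] q2 small by simp
    then show "m < p (p x) \<and> p (p x) \<le> m + ?r"
      using p_le_r_iff[of x] p2_bounds[of x] x small mn by simp
  qed
  show "p \<in> rigid n ?r ?r"
    unfolding rigid_def mem_Collect_eq
  proof (intro conjI allI impI)
    show "?r + ?r \<le> n" using small by auto
    show "(\<lambda>i. if 1 \<le> i \<and> i \<le> ?r then p (?r + i) else i) \<in> avoiders ?r"
    proof (rule block_avoiders)
      fix i assume i: "1 \<le> i" "i \<le> ?r"
      have "1 \<le> ?r + i" "?r + i \<le> n" "?r < ?r + i" "?r + i \<le> q" using i q2 small by linarith+
      then show "p (?r + i) \<le> ?r" using P_iff[of "?r + i"] by blast
    qed (use small in simp)
    fix i :: nat assume i: "1 \<le> i"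
    show "n - ?r < p i" if "i \<le> ?r" using cut_r[of i] i that mn by simp
    show "p (?r + ?r + i) = ?r + i" if "i \<le> n - ?r - ?r" using shift2[of i] i that q2
      by (simp add: mult_2)
    show "p (p (?r + i)) = n - ?r + i" if "i \<le> ?r" using shift3[of i] i that mn by simp
  qed (rule pp)
qed

text \<open>Here \<open>n - q < k\<close>, and \<open>p\<close> translates the positions after
  \<open>q\<close> downwards by \<open>q - (q - k) = k\<close>; evaluated at \<open>n\<close> this
  gives \<open>m = n - k\<close>. Excluding positions between \<open>k\<close> and
  \<open>q - k\<close> then gives \<open>q = 2 * k\<close>.\<close>

lemma rigid_large_q:
  assumes qm: "m < q"
  shows "p \<in> rigid n k (n - q)" "3 * (n - q) < n" "n = 2 * k + (n - q)"
proof -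
  let ?t = "n - q"
  have t1: "1 \<le> ?t" using q_bounds by simp
  have tk: "?t < k"
  proof (rule ccontr)
    assume "\<not> ?t < k"
    then obtain i where i: "q < i" "i \<le> n" "p i = q" using preimage_t[of q] q_bounds pq by auto
    then show False using p_le_m[of i] qm by simp
  qed
  have kq: "k < q" using r_less_q k_le_r by simp
  have A_sub: "q - k < y \<and> y \<le> q - k + ?t" if y: "1 \<le> y" "y \<le> n" "p y \<le> ?t" for y
  proof -
    have "q - k < y" "y \<le> q" using le_k_iff[OF y(1,2)] y tk by auto
    moreover have "\<not> n - k < y"
    proof
      assume a: "n - k < y"
      obtain i where i: "1 \<le> i" "i \<le> n" "p i = y" using preimage y by blast
      then have "i \<le> k" using cut_k[of i] a by simp
      then show False using le_t_iff[of i] i y kq by simp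
    qed
    ultimately show ?thesis using tk kq q_bounds by simp
  qed
  have lastp: "p (q + i) = q - k + i" if "1 \<le> i" "i \<le> ?t" for i
  proof (rule increasing_eq_shift[OF _ _ that])
    fix x y assume "q < x" "x < y" "y \<le> q + ?t"
    then show "p x < p y" using p_incr q_bounds by simp
  next
    fix x assume x: "q < x" "x \<le> q + ?t"
    then have "p (p x) \<le> ?t" using le_t_iff[of x] q_bounds by simp
    then show "q - k < p x \<and> p x \<le> q - k + ?t" using A_sub[of "p x"] p_bounds[of x] x q_bounds by simp
  qed
  have m_eq: "m = n - k"
    using lastp[of ?t] t1 pn q_bounds kq by simp
  have num: "m - ?t = q - k" "q - k + ?t = m" using m_eq kq q_bounds tk by linarith+
  have T: "p x \<le> ?t \<longleftrightarrow> q - k < x \<and> x \<le> m" if x: "1 \<le> x" "x \<le> n" for x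
  proof
    assume "p x \<le> ?t" then show "q - k < x \<and> x \<le> m" using A_sub[OF x] num by linarith
  next
    assume *: "q - k < x \<and> x \<le> m"
    define i where "i = x - (q - k)"
    have i: "1 \<le> i" "i \<le> ?t" "x = q - k + i" unfolding i_def using * num by linarith+
    have "q < q + i" "q + i \<le> n" "1 \<le> q + i" using i q_bounds by linarith+
    then have "p (p (q + i)) \<le> ?t" using le_t_iff[of "q + i"] by blast
    then show "p x \<le> ?t" using lastp[OF i(1,2)] i(3) by metis
  qed
  have m_ge: "2 * k \<le> q"
    using r_plus_k_le_q m_eq km mn by linarith
  \<comment> \<open>Positions strictly after \<open>k\<close> and up to \<open>q - k\<close> would
    be permuted among themselves. Let \<open>a < k\<close> be the position of the value
    \<open>q\<close>: then \<open>a\<close>, \<open>k\<close>, \<open>x\<close> carry the values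
    \<open>k\<close>, \<open>m\<close> and something in between under \<open>p \<circ> p\<close>, a
    132.\<close>
  have none: "\<not> (k < x \<and> x \<le> q - k)" for x
  proof
    assume x: "k < x \<and> x \<le> q - k"
    have step: "k < p y \<and> p y \<le> q - k" if y: "k < y" "y \<le> q - k" for y
    proof -
      have yb: "1 \<le> y" "y \<le> n" "y \<le> q" using y q_bounds by linarith+
      have "\<not> y \<le> n - m" using y m_eq km mn by linarith
      then have "p y \<le> m" using cut_r[OF yb(1,2)] by linarith
      moreover have "k < p y" using le_k_iff[OF yb(1,2)] y by linarith
      moreover have "\<not> p (p y) \<le> ?t" using le_t_iff[OF yb(1,2)] yb by linarith
      then have "\<not> (q - k < p y \<and> p y \<le> m)" using T[OF p_bounds[OF yb(1,2)]] by blast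
      ultimately show ?thesis by linarith
    qed
    have xx: "k < p (p x)" "p (p x) \<le> q - k" using step[of x] step[of "p x"] x by blast+
    obtain a where a: "1 \<le> a" "a \<le> n" "p a = q" using preimage[OF q_bounds(1)] q_bounds(2) by force
    have "a \<le> n - m" using cut_r[OF a(1,2)] a qm by linarith
    then have "a \<le> k" using m_eq by linarith
    moreover have "a \<noteq> k" using pk a q_bounds by auto
    ultimately have "a < k" by linarith
    have "p (p x) < m" using xx(2) t1 num by linarith
    moreover have "x \<le> n" using x q_bounds by linarith
    ultimately show False using av2[of a k x] a(1,3) \<open>a < k\<close> x xx pq p2_k by simp
  qed
  have qn: "q = 2 * k" using none[of "k + 1"] m_ge by force
  have nk: "2 * k < n" "n - 2 * k < k" using qn q_bounds tk by auto
  show "n = 2 * k + (n - q)" using qn nk by linarith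
  show "3 * (n - q) < n" using qn nk by linarith
  \<comment> \<open>The positions from \<open>m + 1\<close> to \<open>q\<close> carry the values
    above \<open>?t\<close> and up to \<open>k\<close>. Position \<open>m\<close> has a value at
    most \<open>?t\<close> and is the 1 that rules out a descent.\<close>
  have shift1: "p (m + i) = ?t + i" if "1 \<le> i" "i \<le> k - ?t" for i
  proof (rule increasing_eq_shift[OF _ _ that])
    have gt: "?t < p x" if "m < x" "x \<le> n" for x using T[of x] that by force
    fix x y assume xy: "m < x" "x < y" "y \<le> m + (k - ?t)"
    then have yn: "y \<le> n" using m_eq qn nk by linarith
    show "p x < p y"
    proof (rule ccontr)
      assume "\<not> p x < p y"
      then have "p y < p x" using xy by (metis linorder_neqE_nat p_eq_iff less_irrefl)
      moreover have m: "1 \<le> m" "m \<le> n" "q - k < m" using m_eq qn nk by linarith+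
      then have "p m < p y" using T[OF m(1,2)] gt[of y] xy yn by force
      ultimately show False using avoids132D[OF av1 m(1) xy(1,2) yn] by blast
    qed
  next
    fix x assume x: "m < x" "x \<le> m + (k - ?t)"
    then have xb: "1 \<le> x" "x \<le> n" "q - k < x" "x \<le> q" using m_eq qn nk by linarith+
    have "p x \<le> k" using le_k_iff[OF xb(1,2)] xb by blast
    moreover have "?t < p x" using T[OF xb(1,2)] x by linarith
    ultimately show "?t < p x \<and> p x \<le> ?t + (k - ?t)" by linarith
  qed
  have I: "p x \<le> k" if "k < x" "x \<le> 2 * k" for x
    using le_k_iff[of x] that qn nk by simp
  have nm: "n - m = k" using m_eq km mn by linarith
  have shift2: "(\<lambda>x. p (p x)) (k + i) = m + i" if "1 \<le> i" "i \<le> k" for i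
  proof (rule increasing_eq_shift[OF _ _ that])
    fix x y assume "k < x" "x < y" "y \<le> k + k"
    then show "p (p x) < p (p y)" using p2_incr[of x y] I[of x] I[of y] nm nk by simp
  next
    fix x assume x: "k < x" "x \<le> k + k"
    then have xb: "1 \<le> x" "x \<le> n" "p x \<le> k" using I[of x] nk by auto
    then have "m < p (p x)" using p_le_r_iff[OF xb(1,2)] nm by simp
    then show "m < p (p x) \<and> p (p x) \<le> m + k"
      using p2_bounds[OF xb(1,2)] nm by linarith
  qed
  show "p \<in> rigid n k ?t"
    unfolding rigid_def mem_Collect_eq
  proof (intro conjI allI impI)
    show "k + ?t \<le> n" using qn nk by linarith
    show "(\<lambda>i. if 1 \<le> i \<and> i \<le> ?t then p (k + i) else i) \<in> avoiders ?t"
    proof (rule block_avoiders)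
      fix i assume i: "1 \<le> i" "i \<le> ?t"
      have "1 \<le> k + i" "k + i \<le> n" "q - k < k + i" "k + i \<le> m" using i m_eq qn nk by linarith+
      then show "p (k + i) \<le> ?t" using T[of "k + i"] by blast
    qed (use qn nk in linarith)
    fix i :: nat assume i: "1 \<le> i"
    show "n - k < p i" if "i \<le> k" using cut_k[of i] i that km mn by simp
    show "p (k + ?t + i) = ?t + i" if "i \<le> n - k - ?t"
    proof (cases "i \<le> k - ?t")
      case True
      have "m = k + ?t" using m_eq qn nk by linarith
      then show ?thesis using shift1[OF i True] by metis
    next
      case False
      define j where "j = i - (k - ?t)"
      have j: "1 \<le> j" "j \<le> ?t" "k + ?t + i = q + j" "q - k + j = ?t + i"
        unfolding j_def using False that qn nk by linarith+
      then show ?thesis using lastp[OF j(1,2)] by metis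
    qed
    show "p (p (k + i)) = n - k + i" if "i \<le> k" using shift2[OF i that] m_eq by simp
  qed (rule pp)
qed

end

text \<open>After position \<open>r\<close>, the block and the translation give \<open>p\<close>
  outright. If \<open>x \<le> r\<close> and \<open>p x = n - r + i\<close>, the formula for
  \<open>p (p (r + i))\<close> yields \<open>p (r + i) = x\<close>, so the first \<open>r\<close>
  entries are read off from the later ones.\<close>

lemma card_rigid_le: "card (rigid n r s) \<le> card (avoiders s)"
proof (rule card_inj_on_le)
  let ?F = "\<lambda>p i. if 1 \<le> i \<and> i \<le> s then p (r + i) else (i::nat)"
  show "?F ` rigid n r s \<subseteq> avoiders s" by (auto simp: rigid_def)
  show "inj_on ?F (rigid n r s)"
  proof (rule inj_onI)
    fix p p' assume p: "p \<in> rigid n r s" and p': "p' \<in> rigid n r s" and eq: "?F p = ?F p'"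
    have pp: "p permutes {1..n}" "p' permutes {1..n}" and le: "r + s \<le> n"
      using p p' by (auto simp: rigid_def)
    have up: "p x = p' x" if x: "r < x" "x \<le> n" for x
    proof (cases "x \<le> r + s")
      case True then show ?thesis using fun_cong[OF eq, of "x - r"] x by (auto split: if_splits)
    next
      case False
      then have "x = r + s + (x - r - s)" "1 \<le> x - r - s" "x - r - s \<le> n - r - s" using x by auto
      then show ?thesis using p p' unfolding rigid_def mem_Collect_eq by metis
    qed
    show "p = p'"
    proof
      fix x
      consider "x = 0 \<or> n < x" | "r < x" "x \<le> n" | "1 \<le> x" "x \<le> r" by force
      then show "p x = p' x"
      proof cases
        case 1 then show ?thesis using pp by (auto simp: permutes_def)
      next
        case 2 then show ?thesis by (rule up)
      next
        case 3
        have xn: "x \<le> n" using 3 le by simp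
        define i where "i = p x - (n - r)"
        have "n - r < p x" using p 3 by (auto simp: rigid_def)
        then have i: "1 \<le> i" "i \<le> r" "p x = n - r + i"
          using permutes_bounds[OF pp(1) 3(1) xn] le by (auto simp: i_def)
        then have "p (p (r + i)) = p x" "p' (p' (r + i)) = p x"
          using p p' by (auto simp: rigid_def)
        then have a: "p (r + i) = x" "p' (p' (r + i)) = p x"
          using permutes_eq_iff[OF pp(1)] by auto
        show ?thesis
        proof (cases "r + i \<le> n")
          case True
          then have "p' (r + i) = x" using up[of "r + i"] a i by simp
          then show ?thesis using a by simp
        next
          \<comment> \<open>The definition of \<open>rigid\<close> does not bound
            \<open>2 * r\<close> by \<open>n\<close>, so \<open>r + i\<close> may lie outside the
            permuted set, where both maps are the identity.\<close>
          case False
          then have "p (r + i) = r + i" "p' (r + i) = r + i" using pp by (auto simp: permutes_def)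
          then show ?thesis using a by simp
        qed
      qed
    qed
  qed
qed simp

section \<open>Counting 132-avoiding permutations and involutions\<close>

text \<open>The decomposition of a 132-avoider at its maximum, as a skew sum: \<open>a\<close> to
  the upper left, \<open>b\<close> to the lower right.\<close>

definition glue :: "nat \<Rightarrow> nat \<Rightarrow> (nat \<Rightarrow> nat) \<Rightarrow> (nat \<Rightarrow> nat) \<Rightarrow> nat \<Rightarrow> nat" where
  "glue n k a b x = (if 1 \<le> x \<and> x \<le> k then a x + (n - k) else if x = Suc k then Suc n
     else if Suc k < x \<and> x \<le> Suc n then b (x - Suc k) else x)"

lemma glue_avoiders:
  assumes k: "k \<le> n" and a: "a \<in> avoiders k" and b: "b \<in> avoiders (n - k)"
  shows "glue n k a b \<in> avoiders (Suc n)"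
proof -
  have ap: "a permutes {1..k}" "avoids132 k a" and bp: "b permutes {1..n - k}" "avoids132 (n - k) b"
    using a b by (auto simp: avoiders_def)
  let ?g = "glue n k a b"
  have gA: "?g x = a x + (n - k)" "n - k < ?g x" "?g x \<le> n" if "1 \<le> x" "x \<le> k" for x
    using that permutes_bounds[OF ap(1) that] k by (auto simp: glue_def)
  have gM: "?g (Suc k) = Suc n" by (simp add: glue_def)
  have gB: "?g x = b (x - Suc k)" "1 \<le> ?g x" "?g x \<le> n - k" if "Suc k < x" "x \<le> Suc n" for x
    using that permutes_bounds[OF bp(1), of "x - Suc k"] k by (auto simp: glue_def)
  have "?g permutes {1..Suc n}"
  proof (rule permutes_atLeastAtMostI)
    fix x assume x: "1 \<le> x" "x \<le> Suc n"
    then consider "x \<le> k" | "x = Suc k" | "Suc k < x" by linarith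
    then show "1 \<le> ?g x \<and> ?g x \<le> Suc n"
      using gA[of x] gB[of x] gM x by cases auto
  next
    fix x y assume xy: "1 \<le> x" "x < y" "y \<le> Suc n"
    then consider "y \<le> k" | "x \<le> k" "y = Suc k" | "x \<le> k" "Suc k < y" | "x = Suc k" | "Suc k < x" by linarith
    then show "?g x \<noteq> ?g y"
    proof cases
      case 1
      then show ?thesis using xy gA(1)[of x] gA(1)[of y] permutes_eq_iff[OF ap(1), of x y] by auto
    next
      case 2 then show ?thesis using xy gA(3)[of x] gM by auto
    next
      case 3 then show ?thesis using xy gA(2)[of x] gB(3)[of y] by auto
    next
      case 4 then show ?thesis using xy gB(3)[of y] gM by auto
    next
      case 5
      then have "x - Suc k \<noteq> y - Suc k" using xy by auto
      then show ?thesis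
        using 5 xy gB(1)[of x] gB(1)[of y] permutes_eq_iff[OF bp(1), of "x - Suc k" "y - Suc k"] by auto
    qed
  qed (use k in \<open>auto simp: glue_def\<close>)
  moreover have "avoids132 (Suc n) ?g"
  proof (rule avoids132I)
    fix i j l assume *: "1 \<le> i" "i < j" "j < l" "l \<le> Suc n" "?g i < ?g l" "?g l < ?g j"
    consider "l \<le> k" | "l = Suc k" | "i \<le> k" "Suc k < l" | "i = Suc k" | "Suc k < i" using * by linarith
    then show False
    proof cases
      case 1
      then show False using avoids132D[OF ap(2), of i j l] * gA(1)[of i] gA(1)[of j] gA(1)[of l] by auto
    next
      case 2 then show False using * gA(3)[of j] gM by auto
    next
      case 3 then show False using * gA(2)[of i] gB(3)[of l] by auto
    next
      case 4 then show False using * gB(3)[of l] gM by auto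
    next
      case 5
      have "l - Suc k \<le> n - k" "i - Suc k < j - Suc k" "j - Suc k < l - Suc k" "1 \<le> i - Suc k" 
        using * 5 by linarith+
      then show False
        using avoids132D[OF bp(2), of "i - Suc k" "j - Suc k" "l - Suc k"]
         * 5 gB(1)[of i] gB(1)[of j] gB(1)[of l] by auto
    qed
  qed
  ultimately show ?thesis by (simp add: avoiders_def)
qed

lemma card_avoiders_max_at:
  assumes k: "k \<le> n"
  shows "card {p \<in> avoiders (Suc n). p (Suc k) = Suc n} = card (avoiders k) * card (avoiders (n - k))"
proof -
  let ?P = "{p \<in> avoiders (Suc n). p (Suc k) = Suc n}"
  let ?a = "\<lambda>p x. if 1 \<le> x \<and> x \<le> k then p x - (n - k) else (x::nat)"
  let ?b = "\<lambda>p x. if 1 \<le> x \<and> x \<le> n - k then p (x + Suc k) else (x::nat)"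
  have "bij_betw (\<lambda>p. (?a p, ?b p)) ?P (avoiders k \<times> avoiders (n - k))"
  proof (rule bij_betw_byWitness[where f' = "\<lambda>(a, b). glue n k a b"])
    have cutP: "n - k < p x" "p x \<le> n" if "p \<in> ?P" "1 \<le> x" "x \<le> k" for p x
    proof -
      have p: "p permutes {1..Suc n}" "avoids132 (Suc n) p" using that by (auto simp: avoiders_def)
      have "Suc n - Suc k < p x"
        using avoids132_before_max[OF p, of "Suc k" x] that k by auto
      moreover have "p x \<noteq> Suc n" using permutes_eq_iff[OF p(1), of x "Suc k"] that by auto
      ultimately show "n - k < p x" "p x \<le> n"
        using permutes_bounds[OF p(1), of x] that k by auto
    qed
    have cutP': "1 \<le> p x" "p x \<le> n - k" if "p \<in> ?P" "Suc k < x" "x \<le> Suc n" for p x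
    proof -
      have p: "p permutes {1..Suc n}" "avoids132 (Suc n) p" using that by (auto simp: avoiders_def)
      have "\<not> Suc n - Suc k < p x"
        using avoids132_before_max[OF p, of "Suc k" x] that k by auto
      then show "1 \<le> p x" "p x \<le> n - k"
        using permutes_bounds[OF p(1), of x] that k by auto
    qed
    show "\<forall>p\<in>?P. (case (?a p, ?b p) of (a, b) \<Rightarrow> glue n k a b) = p"
    proof (rule ballI, rule ext)
      fix p x assume p: "p \<in> ?P"
      have pp: "p permutes {1..Suc n}" using p by (auto simp: avoiders_def)
      consider "x = 0 \<or> Suc n < x" | "1 \<le> x" "x \<le> k" | "x = Suc k" | "Suc k < x" "x \<le> Suc n" by linarith
      then show "(case (?a p, ?b p) of (a, b) \<Rightarrow> glue n k a b) x = p x"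
      proof cases
        case 1
        then have "p x = x" using pp by (auto simp: permutes_def)
        then show ?thesis using 1 k by (auto simp: glue_def)
      next
        case 2
        then show ?thesis using cutP[OF p 2] by (simp add: glue_def)
      next
        case 3
        then show ?thesis using p by (simp add: glue_def)
      next
        case 4
        then have "1 \<le> x - Suc k" "x - Suc k \<le> n - k" by linarith+
        then show ?thesis using 4 by (simp add: glue_def)
      qed
    qed
    show "\<forall>c\<in>avoiders k \<times> avoiders (n - k). (?a (case c of (a, b) \<Rightarrow> glue n k a b), ?b (case c of (a, b) \<Rightarrow> glue n k a b)) = c"
    proof (clarify, intro conjI)
      fix a b assume "a \<in> avoiders k" "b \<in> avoiders (n - k)"
      then have ap: "a permutes {1..k}" and bp: "b permutes {1..n - k}" by (auto simp: avoiders_def)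
      show "?a (glue n k a b) = a"
      proof
        fix x show "?a (glue n k a b) x = a x"
          using ap by (cases "1 \<le> x \<and> x \<le> k") (auto simp: glue_def permutes_def)
      qed
      show "?b (glue n k a b) = b"
      proof
        fix x show "?b (glue n k a b) x = b x"
          using bp k by (cases "1 \<le> x \<and> x \<le> n - k") (auto simp: glue_def permutes_def)
      qed
    qed
    show "(\<lambda>p. (?a p, ?b p)) ` ?P \<subseteq> avoiders k \<times> avoiders (n - k)"
    proof (rule image_subsetI)
      fix p assume p: "p \<in> ?P"
      then have pp: "p permutes {1..Suc n}" "avoids132 (Suc n) p" by (auto simp: avoiders_def)
      have "?a p permutes {1..k}"
      proof (rule permutes_atLeastAtMostI)
        fix x assume x: "1 \<le> x" "x \<le> k" 
        show "1 \<le> ?a p x \<and> ?a p x \<le> k" using cutP[OF p x] x k by auto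
      next
        fix x y assume xy: "1 \<le> x" "x < y" "y \<le> k"
        have "p x \<noteq> p y" using permutes_eq_iff[OF pp(1)] xy by simp
        moreover have "n - k < p x" "n - k < p y" using cutP[OF p, of x] cutP[OF p, of y] xy by auto
        ultimately have "p x - (n - k) \<noteq> p y - (n - k)" by linarith
        then show "?a p x \<noteq> ?a p y" using xy by simp
      qed auto
      moreover have "avoids132 k (?a p)"
      proof (rule avoids132I)
        fix i j l assume *: "1 \<le> i" "i < j" "j < l" "l \<le> k" "?a p i < ?a p l" "?a p l < ?a p j"
        then have "p i - (n - k) < p l - (n - k)" "p l - (n - k) < p j - (n - k)" by auto
        then have "p i < p l" "p l < p j" by linarith+
        then show False using avoids132D[OF pp(2) *(1-3)] * k by simp
      qed
      moreover have "?b p permutes {1..n - k}"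
      proof (rule permutes_atLeastAtMostI)
        fix x assume x: "1 \<le> x" "x \<le> n - k"
        then have "Suc k < x + Suc k" "x + Suc k \<le> Suc n" using k by linarith+
        then show "1 \<le> ?b p x \<and> ?b p x \<le> n - k" using cutP'[OF p, of "x + Suc k"] x by auto
      next
        fix x y assume xy: "1 \<le> x" "x < y" "y \<le> n - k"
        then show "?b p x \<noteq> ?b p y" using permutes_eq_iff[OF pp(1), of "x + Suc k" "y + Suc k"] by auto
      qed auto
      moreover have "avoids132 (n - k) (?b p)"
      proof (rule avoids132I)
        fix i j l assume *: "1 \<le> i" "i < j" "j < l" "l \<le> n - k" "?b p i < ?b p l" "?b p l < ?b p j"
        then have "p (i + Suc k) < p (l + Suc k)" "p (l + Suc k) < p (j + Suc k)" by auto
        moreover have "1 \<le> i + Suc k" "i + Suc k < j + Suc k" "j + Suc k < l + Suc k" "l + Suc k \<le> Suc n"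
          using * k by linarith+
        ultimately show False using avoids132D[OF pp(2), of "i + Suc k" "j + Suc k" "l + Suc k"] by blast
      qed
      ultimately show "(?a p, ?b p) \<in> avoiders k \<times> avoiders (n - k)" by (simp add: avoiders_def)
    qed
    show "(\<lambda>(a, b). glue n k a b) ` (avoiders k \<times> avoiders (n - k)) \<subseteq> ?P"
      using glue_avoiders[OF k] by (auto simp: glue_def)
  qed
  from bij_betw_same_card[OF this] show ?thesis unfolding card_cartesian_product .
qed

lemma card_avoiders_0: "card (avoiders 0) = 1"
proof -
  have "avoiders 0 = {id}" by (auto simp: avoiders_def avoids132_def)
  then show ?thesis by simp
qed

text \<open>The Catalan recurrence, by the number of entries in front of the maximum.\<close>

lemma card_avoiders_Suc: "card (avoiders (Suc n)) = (\<Sum>k\<le>n. card (avoiders k) * card (avoiders (n - k)))"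
proof -
  let ?P = "\<lambda>k. {p \<in> avoiders (Suc n). p (Suc k) = Suc n}"
  have "avoiders (Suc n) = (\<Union>k\<in>{..n}. ?P k)"
  proof
    show "avoiders (Suc n) \<subseteq> (\<Union>k\<in>{..n}. ?P k)"
    proof
      fix p assume p: "p \<in> avoiders (Suc n)"
      then have "p permutes {1..Suc n}" by (simp add: avoiders_def)
      then obtain x where "1 \<le> x" "x \<le> Suc n" "p x = Suc n"
        using permutes_preimage[of p "Suc n" "Suc n"] by auto
      then show "p \<in> (\<Union>k\<in>{..n}. ?P k)" using p by (intro UN_I[of "x - 1"]) auto
    qed
  qed auto
  also have "card \<dots> = (\<Sum>k\<le>n. card (?P k))"
  proof (rule card_UN_disjoint)
    show "\<forall>i\<in>{..n}. \<forall>j\<in>{..n}. i \<noteq> j \<longrightarrow> ?P i \<inter> ?P j = {}"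
    proof (intro ballI impI)
      fix i j :: nat assume "i \<noteq> j"
      show "?P i \<inter> ?P j = {}"
      proof (rule ccontr)
        assume "?P i \<inter> ?P j \<noteq> {}"
        then obtain p where "p \<in> ?P i \<inter> ?P j" by blast
        then have "p \<in> avoiders (Suc n)" "p (Suc i) = p (Suc j)" by auto
        then show False using permutes_eq_iff[of p "{1..Suc n}" "Suc i" "Suc j"] \<open>i \<noteq> j\<close>
          by (simp add: avoiders_def)
      qed
    qed
  qed auto
  also have "\<dots> = (\<Sum>k\<le>n. card (avoiders k) * card (avoiders (n - k)))"
    by (intro sum.cong refl card_avoiders_max_at) auto
  finally show ?thesis .
qed

section \<open>Fixed last points and avoiding involutions\<close>

lemma avoids132_mono:
  assumes "avoids132 n p" "m \<le> n" shows "avoids132 m p"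
  by (rule avoids132I) (use avoids132D[OF assms(1)] assms(2) in \<open>meson order_trans\<close>)

lemma strong_avoiders_fixed_last: "{p \<in> strong_avoiders (Suc n). p (Suc n) = Suc n} \<subseteq> strong_avoiders n"
proof
  fix p assume "p \<in> {p \<in> strong_avoiders (Suc n). p (Suc n) = Suc n}"
  then have p: "p permutes {1..Suc n}" "avoids132 (Suc n) p" "avoids132 (Suc n) (p \<circ> p)" "p (Suc n) = Suc n"
    by (auto simp: strong_avoiders_def strongly_avoids132_def)
  have "p permutes {1..n}"
    by (rule permutes_superset[OF p(1)]) (use p(4) le_Suc_eq in auto)
  then show "p \<in> strong_avoiders n"
    using avoids132_mono[OF p(2)] avoids132_mono[OF p(3)] by (simp add: strong_avoiders_def strongly_avoids132_def)
qed

text \<open>An involution exchanging \<open>k\<close> and \<open>n\<close>, built from the outside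
  in: \<open>a\<close> fills the upper left corner, its mirror image in the diagonal the lower right
  one, and \<open>b\<close> the central square.\<close>

definition nest :: "nat \<Rightarrow> nat \<Rightarrow> (nat \<Rightarrow> nat) \<Rightarrow> (nat \<Rightarrow> nat) \<Rightarrow> nat \<Rightarrow> nat" where
  "nest n k a b x = (if 1 \<le> x \<and> x < k then a x + (n - k) else if x = k then n
     else if k < x \<and> x \<le> n - k then b (x - k) + k
     else if n - k < x \<and> x < n then inv a (x - (n - k)) else if x = n then k else x)"

lemma nest_avoiding_involutions:
  assumes k: "1 \<le> k" "2 * k \<le> n" and a: "a \<in> avoiders (k - 1)" and b: "b \<in> avoiding_involutions (n - 2 * k)"
  shows "nest n k a b \<in> avoiding_involutions n"
proof -
  have ap: "a permutes {1..k - 1}" "avoids132 (k - 1) a"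
    and bp: "b permutes {1..n - 2 * k}" "avoids132 (n - 2 * k) b" "\<And>x. b (b x) = x"
    using a b by (auto simp: avoiders_def avoiding_involutions_def)
  have ip: "inv a permutes {1..k - 1}" by (rule permutes_inv[OF ap(1)])
  have avoiding_involutions: "avoids132 (k - 1) (inv a)" by (rule avoids132_inv[OF ap])
  have inv: "a (inv a x) = x" "inv a (a x) = x" for x using permutes_inverses[OF ap(1)] by auto
  let ?f = "nest n k a b"
  have fA: "?f x = a x + (n - k)" "n - k < ?f x" "?f x < n" if "1 \<le> x" "x < k" for x
  proof -
    have "1 \<le> a x" "a x \<le> k - 1" using that permutes_bounds[OF ap(1), of x] by auto
    moreover show "?f x = a x + (n - k)" using that by (simp add: nest_def)
    ultimately show "n - k < ?f x" "?f x < n" using that k by linarith+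
  qed
  have fk: "?f k = n" using k by (simp add: nest_def)
  have fM: "?f x = b (x - k) + k" "k < ?f x" "?f x \<le> n - k" if "k < x" "x \<le> n - k" for x
  proof -
    have "1 \<le> x - k" "x - k \<le> n - 2 * k" using that by linarith+
    then have "1 \<le> b (x - k)" "b (x - k) \<le> n - 2 * k" using permutes_bounds[OF bp(1)] by auto
    then show "?f x = b (x - k) + k" "k < ?f x" "?f x \<le> n - k" using that k by (auto simp: nest_def)
  qed
  have fC: "?f x = inv a (x - (n - k))" "1 \<le> ?f x" "?f x < k" if "n - k < x" "x < n" for x
  proof -
    have "1 \<le> x - (n - k)" "x - (n - k) \<le> k - 1" using that k by linarith+
    then have "1 \<le> inv a (x - (n - k))" "inv a (x - (n - k)) \<le> k - 1" using permutes_bounds[OF ip] by auto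
    then show "?f x = inv a (x - (n - k))" "1 \<le> ?f x" "?f x < k" using that k by (auto simp: nest_def)
  qed
  have fn: "?f n = k" using k by (auto simp: nest_def)
  have f0: "?f x = x" if "x = 0 \<or> n < x" for x using that k by (auto simp: nest_def)
  have cases: "P" if "x = 0 \<or> n < x \<Longrightarrow> P" "1 \<le> x \<Longrightarrow> x < k \<Longrightarrow> P" "x = k \<Longrightarrow> P" "k < x \<Longrightarrow> x \<le> n - k \<Longrightarrow> P"
    "n - k < x \<Longrightarrow> x < n \<Longrightarrow> P" "x = n \<Longrightarrow> P" for x P using that by linarith
  have ff: "?f (?f x) = x" for x
  proof (rule cases[of x])
    assume "x = 0 \<or> n < x" then show ?thesis using f0 by simp
  next
    assume x: "1 \<le> x" "x < k"
    then show ?thesis using fA[OF x] fC(1)[of "?f x"] inv by simp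
  next
    assume "x = k" then show ?thesis using fk fn by simp
  next
    assume x: "k < x" "x \<le> n - k"
    then show ?thesis using fM[OF x] fM(1)[of "?f x"] bp(3) by simp
  next
    assume x: "n - k < x" "x < n"
    then show ?thesis using fC[OF x] fA(1)[of "?f x"] inv by simp
  next
    assume "x = n" then show ?thesis using fk fn by simp
  qed
  have "?f permutes {1..n}"
  proof (rule permutes_atLeastAtMostI)
    fix x assume x: "1 \<le> x" "x \<le> n"
    then consider "x < k" | "x = k" | "k < x" "x \<le> n - k" | "n - k < x" "x < n" | "x = n" by linarith
    then show "1 \<le> ?f x \<and> ?f x \<le> n"
    proof cases
      case 1 then show ?thesis using fA(2,3)[OF x(1)] by linarith
    next
      case 2 then show ?thesis using fk k by simp
    next
      case 3 then show ?thesis using fM(2,3)[of x] by linarith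
    next
      case 4 then show ?thesis using fC(2,3)[of x] k by linarith
    next
      case 5 then show ?thesis using fn k by simp
    qed
  next
    fix x y :: nat assume "x < y"
    then show "?f x \<noteq> ?f y" using ff[of x] ff[of y] by auto
  qed (rule f0)
  moreover have "avoids132 n ?f"
  proof (rule avoids132I)
    fix i j l assume *: "1 \<le> i" "i < j" "j < l" "l \<le> n" "?f i < ?f l" "?f l < ?f j"
    have top: "n - k < ?f x" if "1 \<le> x" "x \<le> k" for x using that fA[of x] fk k by (cases "x = k") auto
    have bot: "?f x \<le> k" if "n - k < x" "x \<le> n" for x using that fC[of x] fn k by (cases "x = n") auto
    consider "l \<le> k" | "i \<le> k" "k < l" | "k < i" "l \<le> n - k" | "k < i" "i \<le> n - k" "n - k < l" | "n - k < i"
      using * by linarith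
    then show False
    proof cases
      case 1
      have "l \<noteq> k"
      proof
        assume "l = k"
        then show False using fA(3)[of j] fk * by simp
      qed
      then have "l < k" "l \<le> k - 1" using 1 by linarith+
      then show False
        using avoids132D[OF ap(2), of i j l] * fA(1)[of i] fA(1)[of j] fA(1)[of l] by auto
    next
      case 2
      then have "?f l \<le> n - k" using fM(3)[of l] bot[of l] * k by (cases "l \<le> n - k") auto
      then show False using top[of i] 2 * by simp
    next
      case 3
      have "1 \<le> i - k" "i - k < j - k" "j - k < l - k" "l - k \<le> n - 2 * k" using 3 * by linarith+
      then show False
        using avoids132D[OF bp(2), of "i - k" "j - k" "l - k"] 3 * fM(1)[of i] fM(1)[of j] fM(1)[of l] by auto
    next
      case 4 then show False using fM(2)[of i] bot[of l] * by simp
    next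
      case 5
      have "l \<noteq> n"
      proof
        assume "l = n"
        then show False using fC(3)[of j] fn 5 * fC(3)[of i] by simp
      qed
      then have "l < n" using * by simp
      moreover have "1 \<le> i - (n - k)" "i - (n - k) < j - (n - k)" "j - (n - k) < l - (n - k)" "l - (n - k) \<le> k - 1"
        using 5 * \<open>l < n\<close> by linarith+
      ultimately show False
        using avoids132D[OF avoiding_involutions, of "i - (n - k)" "j - (n - k)" "l - (n - k)"] 5 *
          fC(1)[of i] fC(1)[of j] fC(1)[of l] by auto
    qed
  qed
  ultimately show ?thesis using ff by (simp add: avoiding_involutions_def avoiders_def)
qed

text \<open>In an involution the position of the maximum equals the final value, so
  \<open>top_before_bottom\<close> applies with \<open>m = k\<close>, and its two cuts isolate the
  central square.\<close>

lemma card_avoiding_involutions_last: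
  assumes k: "1 \<le> k" "2 * k \<le> n"
  shows "card {p \<in> avoiding_involutions n. p n = k} = card (avoiders (k - 1)) * card (avoiding_involutions (n - 2 * k))"
proof -
  let ?P = "{p \<in> avoiding_involutions n. p n = k}"
  let ?b = "\<lambda>p x. if 1 \<le> x \<and> x \<le> n - 2 * k then p (x + k) - k else (x::nat)"
  have loc: "top_before_bottom n k k p" if "p \<in> ?P" for p
  proof
    show "p \<in> strong_avoiders n" using that avoiding_involutions_subset_strong_avoiders by auto
    have "p (p n) = n" using that by (auto simp: avoiding_involutions_def)
    then show "p k = n" using that by simp
  qed (use that k in auto)
  have mid: "k < p x" "p x \<le> n - k" if "p \<in> ?P" "k < x" "x \<le> n - k" for p x
  proof -
    interpret top_before_bottom n k k p by (rule loc) fact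
    have x: "1 \<le> x" "x \<le> n" using that by linarith+
    show "p x \<le> n - k" using cut_k[OF x] that by simp
    show "k < p x" using cut_r[OF x] that by linarith
  qed
  have "bij_betw (\<lambda>p. (head n k p, ?b p)) ?P (avoiders (k - 1) \<times> avoiding_involutions (n - 2 * k))"
  proof (rule bij_betw_byWitness[where f' = "\<lambda>(a, b). nest n k a b"])
    show "\<forall>p\<in>?P. (case (head n k p, ?b p) of (a, b) \<Rightarrow> nest n k a b) = p"
    proof (rule ballI, rule ext)
      fix p x assume p: "p \<in> ?P"
      interpret top_before_bottom n k k p by (rule loc) fact
      have inv: "p (p y) = y" for y using p by (simp add: avoiding_involutions_def)
      have ha: "head n k p permutes {1..k - 1}" using head_avoiders by (simp add: avoiders_def)
      have hd: "p y = head n k p y + (n - k)" if "1 \<le> y" "y < k" for y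
        using cut_k[of y] that km mn by (simp add: head_def)
      consider "x = 0 \<or> n < x" | "1 \<le> x" "x < k" | "x = k" | "k < x" "x \<le> n - k" | "n - k < x" "x < n" | "x = n"
        by linarith
      then show "(case (head n k p, ?b p) of (a, b) \<Rightarrow> nest n k a b) x = p x"
      proof cases
        case 1
        then have "p x = x" using pp by (auto simp: permutes_def)
        then show ?thesis using 1 k by (auto simp: nest_def)
      next
        case 2 then show ?thesis using hd by (simp add: nest_def)
      next
        case 3 then show ?thesis using pk k_pos by (simp add: nest_def)
      next
        case 4
        have "1 \<le> x - k" "x - k \<le> n - 2 * k" using 4 by linarith+
        then show ?thesis using 4 mid[OF p 4] by (simp add: nest_def)
      next
        case 5
        have x: "1 \<le> x" "x \<le> n" using 5 by linarith+
        have "p (p x) = x" by (rule inv)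
        have "p x \<le> k" using cut_r[OF x] 5 by linarith
        moreover have "p x \<noteq> k" using 5 pk inv by (metis less_irrefl)
        ultimately have "p x < k" by simp
        then have "x = head n k p (p x) + (n - k)" using hd[of "p x"] p_bounds[OF x] inv by simp
        then have "head n k p (p x) = x - (n - k)" by simp
        then have "inv (head n k p) (x - (n - k)) = p x" using permutes_inv_eq[OF ha, of "x - (n - k)" "p x"] by blast
        moreover have "\<not> x < k" "x \<noteq> k" "\<not> x \<le> n - k" using 5 k by linarith+
        ultimately show ?thesis using 5 by (simp add: nest_def)
      next
        case 6 then show ?thesis using pn k by (auto simp: nest_def)
      qed
    qed
    show "\<forall>c\<in>avoiders (k - 1) \<times> avoiding_involutions (n - 2 * k). (head n k (case c of (a, b) \<Rightarrow> nest n k a b),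
        ?b (case c of (a, b) \<Rightarrow> nest n k a b)) = c"
    proof (clarify, intro conjI)
      fix a b assume "a \<in> avoiders (k - 1)" "b \<in> avoiding_involutions (n - 2 * k)"
      then have ap: "a permutes {1..k - 1}" and bp: "b permutes {1..n - 2 * k}"
        by (auto simp: avoiders_def avoiding_involutions_def)
      show "head n k (nest n k a b) = a"
      proof
        fix x show "head n k (nest n k a b) x = a x"
          using ap k by (cases "1 \<le> x \<and> x < k") (auto simp: nest_def head_def permutes_def)
      qed
      show "?b (nest n k a b) = b"
      proof
        fix x show "?b (nest n k a b) x = b x"
          using bp k by (cases "1 \<le> x \<and> x \<le> n - 2 * k") (auto simp: nest_def permutes_def)
      qed
    qed
    show "(\<lambda>p. (head n k p, ?b p)) ` ?P \<subseteq> avoiders (k - 1) \<times> avoiding_involutions (n - 2 * k)"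
    proof (rule image_subsetI)
      fix p assume p: "p \<in> ?P"
      interpret top_before_bottom n k k p by (rule loc) fact
      have inv: "p (p y) = y" for y using p by (simp add: avoiding_involutions_def)
      have md: "k < p (x + k)" "p (x + k) \<le> n - k" "k < x + k" "x + k \<le> n" if "1 \<le> x" "x \<le> n - 2 * k" for x
        using mid[OF p, of "x + k"] that k by auto
      define b where "b = ?b p"
      have b: "b x = p (x + k) - k" "1 \<le> b x" "b x \<le> n - 2 * k" if "1 \<le> x" "x \<le> n - 2 * k" for x
      proof -
        show "b x = p (x + k) - k" using that by (simp add: b_def)
        then show "1 \<le> b x" "b x \<le> n - 2 * k" using md(1,2)[OF that] by linarith+
      qed
      have b_out: "b x = x" if "\<not> (1 \<le> x \<and> x \<le> n - 2 * k)" for x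
        using that by (auto simp: b_def)
      have inv_b: "b (b x) = x" for x
      proof (cases "1 \<le> x \<and> x \<le> n - 2 * k")
        case True
        then have "b x + k = p (x + k)" using b(1)[of x] md(1)[of x] by simp
        then show ?thesis using b(1)[of "b x"] b(2,3)[of x] True inv by simp
      next
        case False then show ?thesis using b_out by simp
      qed
      have "b permutes {1..n - 2 * k}"
      proof (rule permutes_atLeastAtMostI)
        fix x y :: nat assume "x < y"
        then show "b x \<noteq> b y" using inv_b by (metis less_irrefl)
      next
        fix x assume "1 \<le> x" "x \<le> n - 2 * k"
        then show "1 \<le> b x \<and> b x \<le> n - 2 * k" using b(2,3) by blast
      next
        fix x assume "x = 0 \<or> n - 2 * k < x"
        then show "b x = x" by (intro b_out) auto
      qed
      moreover have "avoids132 (n - 2 * k) b"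
      proof (rule avoids132I)
        fix i j l assume *: "1 \<le> i" "i < j" "j < l" "l \<le> n - 2 * k" "b i < b l" "b l < b j"
        then have "p (i + k) < p (l + k)" "p (l + k) < p (j + k)"
          using b(1)[of i] b(1)[of j] b(1)[of l] by linarith+
        moreover have "l + k \<le> n" using * k by linarith
        ultimately show False using avoids132D[OF av1, of "i + k" "j + k" "l + k"] * k by simp
      qed
      ultimately have "?b p \<in> avoiding_involutions (n - 2 * k)" using inv_b unfolding b_def[symmetric] by (simp add: avoiding_involutions_def avoiders_def)
      then show "(head n k p, ?b p) \<in> avoiders (k - 1) \<times> avoiding_involutions (n - 2 * k)" using head_avoiders by simp
    qed
    show "(\<lambda>(a, b). nest n k a b) ` (avoiders (k - 1) \<times> avoiding_involutions (n - 2 * k)) \<subseteq> ?P"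
      using nest_avoiding_involutions[OF k] k by (auto simp: nest_def)
  qed
  from bij_betw_same_card[OF this] show ?thesis unfolding card_cartesian_product .
qed

lemma avoiding_involutions_fixed_last: "{p \<in> avoiding_involutions (Suc n). p (Suc n) = Suc n} = avoiding_involutions n"
proof
  show "{p \<in> avoiding_involutions (Suc n). p (Suc n) = Suc n} \<subseteq> avoiding_involutions n"
  proof
    fix p assume p: "p \<in> {p \<in> avoiding_involutions (Suc n). p (Suc n) = Suc n}"
    then have "p \<in> strong_avoiders n" using avoiding_involutions_subset_strong_avoiders[of "Suc n"] strong_avoiders_fixed_last[of n] by auto
    then show "p \<in> avoiding_involutions n" using p by (auto simp: avoiding_involutions_def avoiders_def strong_avoiders_def strongly_avoids132_def)
  qed
  show "avoiding_involutions n \<subseteq> {p \<in> avoiding_involutions (Suc n). p (Suc n) = Suc n}"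
  proof
    fix p assume p: "p \<in> avoiding_involutions n"
    then have pp: "p permutes {1..n}" "avoids132 n p" "\<And>x. p (p x) = x" by (auto simp: avoiding_involutions_def avoiders_def)
    have last: "p (Suc n) = Suc n" using pp(1) by (simp add: permutes_def)
    have "p permutes {1..Suc n}" by (rule permutes_subset[OF pp(1)]) auto
    moreover have "avoids132 (Suc n) p"
    proof (rule avoids132I)
      fix i j k assume *: "1 \<le> i" "i < j" "j < k" "k \<le> Suc n" "p i < p k" "p k < p j"
      have "k \<noteq> Suc n" using permutes_bounds(2)[OF pp(1), of j] * last by auto
      then show False using avoids132D[OF pp(2), of i j k] * by simp
    qed
    ultimately show "p \<in> {p \<in> avoiding_involutions (Suc n). p (Suc n) = Suc n}"
      using last pp(3) by (simp add: avoiding_involutions_def avoiders_def)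
  qed
qed

lemma card_avoiding_involutions_not_fixed_last:
  "card {p \<in> avoiding_involutions n. p n \<noteq> n} = (\<Sum>k = 1..n div 2. card (avoiders (k - 1)) * card (avoiding_involutions (n - 2 * k)))"
proof -
  let ?P = "\<lambda>k. {p \<in> avoiding_involutions n. p n = k}"
  have "{p \<in> avoiding_involutions n. p n \<noteq> n} = (\<Union>k\<in>{1..n div 2}. ?P k)"
  proof
    show "{p \<in> avoiding_involutions n. p n \<noteq> n} \<subseteq> (\<Union>k\<in>{1..n div 2}. ?P k)"
    proof
      fix p assume p: "p \<in> {p \<in> avoiding_involutions n. p n \<noteq> n}"
      then have pp: "p permutes {1..n}" "p (p n) = n" "p n \<noteq> n" by (auto simp: avoiding_involutions_def avoiders_def)
      have "n \<in> {1..n}" using pp(1,3) by (meson permutes_def)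
      then have "1 \<le> p n" "p n < n" using permutes_bounds[OF pp(1), of n] pp(3) by auto
      then interpret top_before_bottom n "p n" "p n" p
        using p pp avoiding_involutions_subset_strong_avoiders by unfold_locales auto
      have "p n \<le> n div 2" using k_le_r by linarith
      then show "p \<in> (\<Union>k\<in>{1..n div 2}. ?P k)" using p k_pos by auto
    qed
    show "(\<Union>k\<in>{1..n div 2}. ?P k) \<subseteq> {p \<in> avoiding_involutions n. p n \<noteq> n}" by auto
  qed
  also have "card \<dots> = (\<Sum>k = 1..n div 2. card (?P k))"
    by (rule card_UN_disjoint) auto
  also have "\<dots> = (\<Sum>k = 1..n div 2. card (avoiders (k - 1)) * card (avoiding_involutions (n - 2 * k)))"
  proof (rule sum.cong[OF refl], rule card_avoiding_involutions_last)
    fix k assume "k \<in> {1..n div 2}"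
    then show "1 \<le> k" "2 * k \<le> n" by auto
  qed
  finally show ?thesis .
qed

lemma card_avoiding_involutions_Suc: "card (avoiding_involutions (Suc n)) = card (avoiding_involutions n) + card {p \<in> avoiding_involutions (Suc n). p (Suc n) \<noteq> Suc n}"
proof -
  have "avoiding_involutions (Suc n) = {p \<in> avoiding_involutions (Suc n). p (Suc n) = Suc n} \<union> {p \<in> avoiding_involutions (Suc n). p (Suc n) \<noteq> Suc n}"
    by auto
  then have "card (avoiding_involutions (Suc n)) = card {p \<in> avoiding_involutions (Suc n). p (Suc n) = Suc n} + card {p \<in> avoiding_involutions (Suc n). p (Suc n) \<noteq> Suc n}"
    by (metis (no_types, lifting) card_Un_disjoint disjoint_iff finite_Un finite_avoiding_involutions mem_Collect_eq)
  then show ?thesis by (simp add: avoiding_involutions_fixed_last)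
qed

section \<open>Recursive inequalities for strong avoiders\<close>

text \<open>The convention for j = 0 lets all strong avoiders take part in the recursion on j.\<close>
definition three_cycles_level :: "nat \<Rightarrow> nat \<Rightarrow> (nat \<Rightarrow> nat) set" where
  "three_cycles_level j n = (if j = 0 then strong_avoiders n else {p \<in> three_cycles n. j \<le> card (cuts n p)})"

lemma three_cycles_three_cycle:
  assumes "p \<in> three_cycles n" shows "three_cycle n (p (p n)) (p n) p"
  by unfold_locales (use assms in \<open>auto simp: three_cycles_def\<close>)

lemma cuts_subset: "cuts n p \<subseteq> {1..n}"
  by (auto simp: cuts_def)

lemma zero_not_in_cuts: "0 \<notin> cuts n p"
  by (simp add: cuts_def)

lemma finite_cuts [simp]: "finite (cuts n p)"
  by (rule finite_subset[OF cuts_subset]) simp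

lemma three_cycles_level_subset: "three_cycles_level j n \<subseteq> strong_avoiders n"
  by (auto simp: three_cycles_level_def three_cycles_def)

lemma finite_three_cycles_level [simp]: "finite (three_cycles_level j n)"
  by (rule finite_subset[OF three_cycles_level_subset finite_strong_avoiders])

lemma card_cuts_le: "card (cuts n p) \<le> n"
  using card_mono[OF _ cuts_subset[of n p]] by simp

lemma three_cycles_level_empty: "n < j \<Longrightarrow> three_cycles_level j n = {}"
proof -
  assume "n < j"
  then have "\<not> j \<le> card (cuts n p)" "j \<noteq> 0" for p using card_cuts_le[of n p] by linarith+
  then show ?thesis by (simp add: three_cycles_level_def)
qed

lemma (in three_cycle) k_cut: "k \<in> cuts n p"
  using k_le_r cut_k k_pos pn by (auto simp: cuts_def)

lemma three_cycles_level_1: "three_cycles_level 1 n = three_cycles n"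
proof -
  have "1 \<le> card (cuts n p)" if "p \<in> three_cycles n" for p
  proof -
    interpret three_cycle n "p (p n)" "p n" p by (rule three_cycles_three_cycle[OF that])
    have "card {p (p n)} \<le> card (cuts n p)" by (rule card_mono) (use k_cut in auto)
    then show ?thesis by simp
  qed
  then show ?thesis by (auto simp: three_cycles_level_def)
qed

text \<open>Lets a cut, or 0 in place of a cut, be encoded by its rank, which unlike the cut itself
  can be compared with the level.\<close>

lemma rank_inj:
  fixes C :: "nat set"
  assumes "finite C" "h = 0 \<or> h \<in> C" "h' = 0 \<or> h' \<in> C" "0 \<notin> C"
    and eq: "card {x \<in> C. x \<le> h} = card {x \<in> C. x \<le> h'}"
  shows "h = h'"
proof -
  have "\<not> a < b" if "b = 0 \<or> b \<in> C" "card {x \<in> C. x \<le> a} = card {x \<in> C. x \<le> b}" for a b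
  proof
    assume "a < b"
    then have "b \<in> {x \<in> C. x \<le> b} - {x \<in> C. x \<le> a}" using that(1) by auto
    moreover have "{x \<in> C. x \<le> a} \<subseteq> {x \<in> C. x \<le> b}" using \<open>a < b\<close> by auto
    ultimately have "{x \<in> C. x \<le> a} \<subset> {x \<in> C. x \<le> b}" by blast
    then have "card {x \<in> C. x \<le> a} < card {x \<in> C. x \<le> b}"
      using assms(1) by (intro psubset_card_mono) auto
    then show False using that by simp
  qed
  then show ?thesis using assms by (metis linorder_neqE_nat)
qed

text \<open>Peeling off the outer three-cycle block leaves a strong avoider, and the only other datum needed to
  restore p is either nothing (i = 0) or the rank i of one of its cuts; this rank is at least the number of
  cuts of p minus one.\<close>
lemma card_three_cycles_level_le:
  assumes j: "1 \<le> j"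
  shows "card (three_cycles_level j n) \<le> (\<Sum>k = 1..n div 3. card (avoiders (k - 1)) * (\<Sum>i = j - 1..n. card (three_cycles_level i (n - 3 * k))))"
proof -
  define cc where "cc p = cuts (n - 3 * p (p n)) (peel n (p (p n)) (p n) p)" for p
  \<comment> \<open>The cut \<open>n - m\<close> of \<open>p\<close> as it appears in the peeled
    pattern. It is 0 when \<open>m = n - k\<close> and a genuine cut otherwise, so its rank
    determines \<open>m\<close> once \<open>k\<close> and the pattern are known.\<close>
  define hh where "hh p = n - p n - p (p n)" for p
  define F where "F p = (p (p n), head n (p (p n)) p, card {h \<in> cc p. h \<le> hh p}, peel n (p (p n)) (p n) p)" for p
  define T where "T = (SIGMA k:{1..n div 3}. avoiders (k - 1) \<times> (SIGMA i:{j - 1..n}. three_cycles_level i (n - 3 * k)))"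
  have h0: "hh p = 0 \<or> hh p \<in> cc p" if "p \<in> three_cycles n" for p
  proof -
    interpret three_cycle n "p (p n)" "p n" p by (rule three_cycles_three_cycle[OF that])
    show ?thesis
    proof (cases "p (p n) < n - p n")
      case True
      then show ?thesis using peel_three_cycles(2) by (simp add: hh_def cc_def)
    next
      case False
      then show ?thesis by (simp add: hh_def)
    qed
  qed
  have c0: "0 \<notin> cc p" "finite (cc p)" for p by (simp_all add: cc_def zero_not_in_cuts)
  have "card (three_cycles_level j n) \<le> card T"
  proof (rule card_inj_on_le)
    show "inj_on F (three_cycles_level j n)"
    proof (rule inj_onI)
      fix p p' assume p: "p \<in> three_cycles_level j n" "p' \<in> three_cycles_level j n" and eq: "F p = F p'"
      then have tp: "p \<in> three_cycles n" "p' \<in> three_cycles n" using j by (auto simp: three_cycles_level_def)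
      interpret A: three_cycle n "p (p n)" "p n" p by (rule three_cycles_three_cycle[OF tp(1)])
      interpret B: three_cycle n "p' (p' n)" "p' n" p' by (rule three_cycles_three_cycle[OF tp(2)])
      have k: "p (p n) = p' (p' n)" and hd: "head n (p (p n)) p = head n (p' (p' n)) p'"
        and pe: "peel n (p (p n)) (p n) p = peel n (p' (p' n)) (p' n) p'"
        and rk: "card {h \<in> cc p. h \<le> hh p} = card {h \<in> cc p'. h \<le> hh p'}"
        using eq by (auto simp: F_def)
      have "cc p = cc p'" using k pe by (simp add: cc_def)
      then have "hh p = hh p'"
        using rank_inj[of "cc p" "hh p" "hh p'"] h0[OF tp(1)] h0[OF tp(2)] c0 rk by simp
      then have "p n = p' n" using k A.k_le_r B.k_le_r A.mn B.mn by (simp add: hh_def)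
      then show "p = p'"
        using three_cycle_eqI[OF A.three_cycle_axioms] B.three_cycle_axioms k hd pe by metis
    qed
    show "F ` three_cycles_level j n \<subseteq> T"
    proof (rule image_subsetI)
      fix p assume p: "p \<in> three_cycles_level j n"
      then have tp: "p \<in> three_cycles n" and cp: "j \<le> card (cuts n p)" using j by (auto simp: three_cycles_level_def)
      interpret three_cycle n "p (p n)" "p n" p by (rule three_cycles_three_cycle[OF tp])
      let ?k = "p (p n)"
      have cc: "cc p = cuts N t" by (simp add: cc_def)
      have hh: "hh p = n - p n - ?k" by (simp add: hh_def)
      let ?R = "{h \<in> cc p. h \<le> hh p}"
      have fR: "finite ?R" using c0 by simp
      have "card (cuts n p) \<le> card (insert ?k ((\<lambda>h. h + ?k) ` ?R))"
        using cuts_peel fR unfolding cc hh by (intro card_mono) auto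
      also have "\<dots> \<le> Suc (card ((\<lambda>h. h + ?k) ` ?R))" by (rule card_insert_le_m1) auto
      also have "\<dots> \<le> Suc (card ?R)" using card_image_le[OF fR] by simp
      finally have lo: "j - 1 \<le> card ?R" using cp by linarith
      have "card ?R \<le> card (cuts N t)" unfolding cc by (intro card_mono) auto
      then have hi: "card ?R \<le> n" using card_cuts_le[of N t] by linarith
      \<comment> \<open>Rank 0 asks nothing of \<open>t\<close> beyond strong avoidance. A positive
        rank forces \<open>k < n - m\<close>, and then \<open>t\<close> is itself in
        \<open>three_cycles\<close>.\<close>
      have t: "t \<in> three_cycles_level (card ?R) N"
      proof (cases "card ?R = 0")
        case True then show ?thesis using peel_strong_avoiders by (simp add: three_cycles_level_def)
      next
        case False
        then obtain h where "h \<in> cc p" "h \<le> hh p" using fR by (metis (no_types, lifting) card_eq_0_iff empty_Collect_eq)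
        then have "1 \<le> hh p" using c0(1)[of p] by (cases h) auto
        then have "?k < n - p n" using hh by linarith
        then have "t \<in> three_cycles N" by (rule peel_three_cycles(1))
        moreover have "card ?R \<le> card (cuts N t)" unfolding cc by (intro card_mono) auto
        ultimately show ?thesis unfolding three_cycles_level_def using False by (simp only: if_False) blast
      qed
      have "3 * ?k \<le> n" using k2_le_m k_le_r mn by linarith
      then have "?k \<in> {1..n div 3}" using k_pos by auto
      then show "F p \<in> T" using head_avoiders lo hi t by (simp add: F_def T_def)
    qed
    show "finite T" by (simp add: T_def)
  qed
  also have "card T = (\<Sum>k = 1..n div 3. card (avoiders (k - 1)) * (\<Sum>i = j - 1..n. card (three_cycles_level i (n - 3 * k))))"
    by (simp add: T_def card_SigmaI card_cartesian_product)
  finally show ?thesis .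
qed

section \<open>Case distinction over all strong avoiders\<close>

definition max_left_of_last :: "nat \<Rightarrow> (nat \<Rightarrow> nat) set" where
  "max_left_of_last n = {p \<in> strong_avoiders n. p n < n \<and> inv p n < p n}"

text \<open>The trichotomy of \<open>q\<close> against \<open>m\<close>. For \<open>m < q\<close>
  the parameter \<open>k\<close> is recovered from \<open>n = 2 * k + s\<close>, so the union runs
  over \<open>s\<close> alone.\<close>

lemma max_left_of_last_subset:
  "max_left_of_last n \<subseteq> three_cycles n \<union> (\<Union>s\<in>{s. 3 * s < n}. rigid n s s \<union> rigid n ((n - s) div 2) s)"
proof
  fix p assume p: "p \<in> max_left_of_last n"
  then have pp: "p permutes {1..n}" by (auto simp: max_left_of_last_def strong_avoiders_def)
  interpret top_strictly_before_bottom n "inv p n" "p n" p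
    by unfold_locales (use p permutes_inverses[OF pp] in \<open>auto simp: max_left_of_last_def\<close>)
  consider "q < p n" | "q = p n" | "p n < q" by linarith
  then show "p \<in> three_cycles n \<union> (\<Union>s\<in>{s. 3 * s < n}. rigid n s s \<union> rigid n ((n - s) div 2) s)"
  proof cases
    case 1 then show ?thesis using rigid_small_q by auto
  next
    case 2
    then have "p (p n) = inv p n" using pq by simp
    then have "p \<in> three_cycles n" using p p_strong_avoiders pk by (auto simp: three_cycles_def max_left_of_last_def)
    then show ?thesis by simp
  next
    case 3
    have "(n - (n - q)) div 2 = inv p n" using rigid_large_q(3)[OF 3] by linarith
    then show ?thesis using rigid_large_q(1,2)[OF 3] by auto
  qed
qed

lemma card_max_left_of_last_le: "card (max_left_of_last n) \<le> card (three_cycles n) + 2 * (\<Sum>s | 3 * s < n. card (avoiders s))"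
proof -
  let ?E = "\<lambda>s. rigid n s s \<union> rigid n ((n - s) div 2) s"
  have fin: "finite {s::nat. 3 * s < n}" by (rule finite_subset[of _ "{..n}"]) auto
  have finE: "finite (rigid n r s)" for r s
    by (rule finite_subset[OF _ finite_permutes[of n]]) (auto simp: rigid_def)
  have "card (max_left_of_last n) \<le> card (three_cycles n \<union> (\<Union>s\<in>{s. 3 * s < n}. ?E s))"
    by (rule card_mono[OF _ max_left_of_last_subset]) (use fin finE in \<open>auto simp: three_cycles_def\<close>)
  also have "\<dots> \<le> card (three_cycles n) + card (\<Union>s\<in>{s. 3 * s < n}. ?E s)" by (rule card_Un_le)
  also have "card (\<Union>s\<in>{s. 3 * s < n}. ?E s) \<le> (\<Sum>s | 3 * s < n. card (?E s))"
    by (rule card_UN_le[OF fin])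
  also have "\<dots> \<le> (\<Sum>s | 3 * s < n. 2 * card (avoiders s))"
  proof (rule sum_mono)
    fix s show "card (?E s) \<le> 2 * card (avoiders s)"
      using card_Un_le[of "rigid n s s" "rigid n ((n - s) div 2) s"] card_rigid_le[of n s s]
        card_rigid_le[of n "(n - s) div 2" s] by linarith
  qed
  finally show ?thesis by (simp add: sum_distrib_left)
qed

text \<open>The split compares the position of the maximum with the final value. Inversion exchanges
  the two, hence the factor 2; equality makes \<open>p\<close> an involution.\<close>

lemma card_strong_avoiders_Suc_le:
  "card (strong_avoiders (Suc n)) \<le> card (strong_avoiders n) + card {p \<in> avoiding_involutions (Suc n). p (Suc n) \<noteq> Suc n} + 2 * card (max_left_of_last (Suc n))"
proof -
  let ?n = "Suc n"
  let ?A = "{p \<in> strong_avoiders ?n. p ?n = ?n}" and ?B = "{p \<in> avoiding_involutions ?n. p ?n \<noteq> ?n}" and ?C = "max_left_of_last ?n"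
    and ?D = "inv ` max_left_of_last ?n"
  have "strong_avoiders ?n \<subseteq> ?A \<union> ?B \<union> ?C \<union> ?D"
  proof
    fix p assume p: "p \<in> strong_avoiders ?n"
    then have pp: "p permutes {1..?n}" by (simp add: strong_avoiders_def)
    have ip: "inv p permutes {1..?n}" by (rule permutes_inv[OF pp])
    have pi: "p (inv p x) = x" "inv p (p x) = x" for x using permutes_inverses[OF pp] by auto
    show "p \<in> ?A \<union> ?B \<union> ?C \<union> ?D"
    proof (cases "p ?n = ?n")
      case True then show ?thesis using p by simp
    next
      case False
      then have "inv p ?n \<noteq> ?n" using pi(1)[of ?n] by metis
      then have ne: "p ?n < ?n" "inv p ?n < ?n"
        using permutes_bounds(2)[OF pp, of ?n] permutes_bounds(2)[OF ip, of ?n] False by simp_all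
      consider "inv p ?n < p ?n" | "inv p ?n = p ?n" | "p ?n < inv p ?n" by linarith
      then show ?thesis
      proof cases
        case 1 then show ?thesis using p ne by (simp add: max_left_of_last_def)
      next
        case 2
        interpret top_before_bottom ?n "inv p ?n" "p ?n" p
          by unfold_locales (use p ne pi(1)[of ?n] 2 in simp_all)
        have "p \<in> avoiding_involutions ?n" using fixed_of_k_eq_m[OF 2] pp av1 by (simp add: avoiding_involutions_def avoiders_def)
        then show ?thesis using False by simp
      next
        case 3
        have "inv (inv p) = p" using permutes_inv_inv[OF pp] .
        moreover from this have "inv p \<in> max_left_of_last ?n" using strong_avoiders_inv[OF p] 3 ne by (simp add: max_left_of_last_def)
        ultimately have "p \<in> ?D" by (intro image_eqI[of p inv "inv p"]) simp_all
        then show ?thesis by (rule UnI2)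
      qed
    qed
  qed
  moreover have finC: "finite ?C" by (rule finite_subset[OF _ finite_strong_avoiders[of ?n]]) (auto simp: max_left_of_last_def)
  ultimately have "card (strong_avoiders ?n) \<le> card (?A \<union> ?B \<union> ?C \<union> ?D)"
    by (intro card_mono) auto
  also have "\<dots> \<le> card ?A + card ?B + card ?C + card ?D"
    using card_Un_le[of "?A \<union> ?B \<union> ?C" ?D] card_Un_le[of "?A \<union> ?B" ?C] card_Un_le[of ?A ?B] by linarith
  also have "card ?D \<le> card ?C" by (rule card_image_le[OF finC])
  also have "card ?A \<le> card (strong_avoiders n)" by (rule card_mono[OF finite_strong_avoiders strong_avoiders_fixed_last])
  finally show ?thesis by linarith
qed

section \<open>Generating functions\<close>

abbreviation avoiders_count :: "nat \<Rightarrow> real" where "avoiders_count n \<equiv> real (card (avoiders n))"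
abbreviation inv_count :: "nat \<Rightarrow> real" where "inv_count n \<equiv> real (card (avoiding_involutions n))"

lemma avoiders_count_0: "avoiders_count 0 = 1" by (simp add: card_avoiders_0)

lemma avoiders_count_Suc: "avoiders_count (Suc n) = (\<Sum>k\<le>n. avoiders_count k * avoiders_count (n - k))"
  by (simp add: card_avoiders_Suc)

text \<open>\<open>s\<close> is a supersolution of the Catalan equation
  \<open>S = 1 + x * S\<^sup>2\<close>. Partial sums stay below it because the triangle of index
  pairs in the recursion lies inside the square.\<close>

lemma sum_avoiders_count_power_le:
  assumes "0 \<le> x" "1 + x * s\<^sup>2 \<le> s"
  shows "(\<Sum>i<n. avoiders_count i * x ^ i) \<le> s"
proof (induction n)
  case 0
  have "0 \<le> x * s\<^sup>2" using assms by simp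
  then have "0 \<le> s" using assms by linarith
  then show ?case by simp
next
  case (Suc n)
  let ?f = "\<lambda>i. avoiders_count i * x ^ i"
  have fn: "0 \<le> ?f i" for i using assms by simp
  have "(\<Sum>i<Suc n. ?f i) = 1 + (\<Sum>i<n. ?f (Suc i))"
    by (simp only: sum.lessThan_Suc_shift avoiders_count_0) simp
  also have "(\<Sum>i<n. ?f (Suc i)) = (\<Sum>i<n. x * (\<Sum>k\<le>i. ?f k * ?f (i - k)))"
  proof (rule sum.cong[OF refl])
    fix i
    have "?f (Suc i) = (\<Sum>k\<le>i. x * (avoiders_count k * avoiders_count (i - k) * (x ^ k * x ^ (i - k))))"
      by (simp add: avoiders_count_Suc sum_distrib_left sum_distrib_right power_add[symmetric] mult_ac)
    then show "?f (Suc i) = x * (\<Sum>k\<le>i. ?f k * ?f (i - k))"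
      by (simp add: sum_distrib_left mult_ac)
  qed
  also have "\<dots> = x * (\<Sum>i<n. \<Sum>k\<le>i. ?f k * ?f (i - k))"
    by (simp add: sum_distrib_left)
  also have "(\<Sum>i<n. \<Sum>k\<le>i. ?f k * ?f (i - k)) = (\<Sum>(i, j)\<in>{(i, j). i + j < n}. ?f i * ?f j)"
    by (rule sum.triangle_reindex[symmetric])
  also have "\<dots> \<le> (\<Sum>(i, j)\<in>{..<n} \<times> {..<n}. ?f i * ?f j)"
    by (rule sum_mono2) (use fn assms in \<open>auto intro!: mult_nonneg_nonneg\<close>)
  also have "\<dots> = (\<Sum>i<n. ?f i)\<^sup>2"
    by (simp add: power2_eq_square sum_product sum.cartesian_product)
  also have "\<dots> \<le> s\<^sup>2"
    by (rule power_mono[OF Suc]) (use fn in \<open>auto intro: sum_nonneg\<close>)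
  finally have "(\<Sum>i<Suc n. ?f i) \<le> 1 + x * s\<^sup>2"
    using assms(1) by (simp add: mult_left_mono)
  then show ?case using assms by simp
qed

lemma avoiders_count_le: "avoiders_count n \<le> 2 * 4 ^ n"
proof -
  have "avoiders_count n * (1 / 4) ^ n \<le> (\<Sum>i<Suc n. avoiders_count i * (1 / 4) ^ i)"
    by (simp add: sum_nonneg)
  also have "\<dots> \<le> 2" by (rule sum_avoiders_count_power_le) auto
  finally show ?thesis by (simp add: power_divide field_simps)
qed

text \<open>The recursion forces the sum S to satisfy S = 1 + S^2 / 4.\<close>
lemma avoiders_count_sums: "(\<lambda>i. avoiders_count i / 4 ^ i) sums 2"
proof -
  let ?f = "\<lambda>i. avoiders_count i / 4 ^ i"
  have "(\<Sum>i<n. ?f i) \<le> 2" for n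
    using sum_avoiders_count_power_le[of "1 / 4" 2 n] by (simp add: power_divide)
  then have s: "summable ?f" by (intro summableI_nonneg_bounded[where x = 2]) auto
  define S where "S = suminf ?f"
  have "(\<lambda>n. \<Sum>k\<le>n. ?f k * ?f (n - k)) sums (S * S)"
    unfolding S_def by (rule Cauchy_product_sums) (use s in \<open>simp_all\<close>)
  also have "(\<lambda>n. \<Sum>k\<le>n. ?f k * ?f (n - k)) = (\<lambda>n. 4 * ?f (Suc n))"
  proof
    fix n
    have "?f k * ?f (n - k) = avoiders_count k * avoiders_count (n - k) / 4 ^ n" if "k \<le> n" for k
      using that by (simp add: power_add[symmetric])
    then have "(\<Sum>k\<le>n. ?f k * ?f (n - k)) = (\<Sum>k\<le>n. avoiders_count k * avoiders_count (n - k) / 4 ^ n)"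
      by (intro sum.cong) auto
    then show "(\<Sum>k\<le>n. ?f k * ?f (n - k)) = 4 * ?f (Suc n)"
      by (simp add: avoiders_count_Suc sum_divide_distrib sum_distrib_left)
  qed
  finally have "(\<lambda>n. ?f (Suc n)) sums (S * S / 4)"
    using sums_divide[of "\<lambda>n. 4 * ?f (Suc n)" "S * S" 4] by (simp add: mult.commute)
  then have "?f sums (S * S / 4 + 1)" by (subst (asm) sums_Suc_iff) (simp add: avoiders_count_0)
  then have "S = S * S / 4 + 1" unfolding S_def by (simp add: sums_iff)
  then have "(S - 2)\<^sup>2 = 0" by (simp add: power2_eq_square algebra_simps)
  then have "S = 2" by simp
  then show ?thesis using summable_sums[OF s] S_def by simp
qed

lemma sum_shift_avoiders_count:
  "(\<Sum>k = 1..n. avoiders_count (k - 1) * x ^ k) = x * (\<Sum>i<n. avoiders_count i * x ^ i)"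
proof -
  have "(\<Sum>k = 1..n. avoiders_count (k - 1) * x ^ k) = (\<Sum>i<n. avoiders_count i * x ^ Suc i)"
    by (rule sum.reindex_bij_witness[of _ Suc "\<lambda>k. k - 1"]) auto
  then show ?thesis by (simp add: sum_distrib_left mult_ac)
qed

section \<open>The involution numbers\<close>

definition inv_new :: "nat \<Rightarrow> real" where
  "inv_new n = (\<Sum>k = 1..n div 2. avoiders_count (k - 1) * inv_count (n - 2 * k))"

lemma inv_new_eq: "inv_new n = real (card {p \<in> avoiding_involutions n. p n \<noteq> n})"
  by (simp add: inv_new_def card_avoiding_involutions_not_fixed_last)

lemma inv_count_Suc: "inv_count (Suc n) = inv_count n + inv_new (Suc n)"
  by (simp add: inv_new_eq card_avoiding_involutions_Suc)

lemma inv_count_0: "inv_count 0 = 1"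
proof -
  have "avoiding_involutions 0 = {id}" by (auto simp: avoiding_involutions_def avoiders_def avoids132_def)
  then show ?thesis by simp
qed

text \<open>The doubling relations of the central binomial coefficients
  \<open>n choose (n div 2)\<close>. They pass through the recursion term by term, and the
  deviations recombine into one Catalan convolution.\<close>

lemma inv_count_double:
  "inv_count (2 * m + 1) = 2 * inv_count (2 * m) - avoiders_count m \<and>
   inv_count (2 * m + 2) = 2 * inv_count (2 * m + 1)"
proof (induction m rule: less_induct)
  case (less m)
  have odd: "inv_new (2 * m + 1) = 2 * inv_new (2 * m) - (\<Sum>k = 1..m. avoiders_count (k - 1) * avoiders_count (m - k))"
  proof -
    have "inv_new (2 * m + 1) = (\<Sum>k = 1..m. avoiders_count (k - 1) * inv_count (2 * m + 1 - 2 * k))"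
      by (simp add: inv_new_def)
    also have "\<dots> = (\<Sum>k = 1..m. 2 * (avoiders_count (k - 1) * inv_count (2 * m - 2 * k)) - avoiders_count (k - 1) * avoiders_count (m - k))"
    proof (rule sum.cong[OF refl])
      fix k assume k: "k \<in> {1..m}"
      then have e: "2 * m + 1 - 2 * k = 2 * (m - k) + 1" "2 * m - 2 * k = 2 * (m - k)" by auto
      have "inv_count (2 * (m - k) + 1) = 2 * inv_count (2 * (m - k)) - avoiders_count (m - k)"
        using less[of "m - k"] k by auto
      then show "avoiders_count (k - 1) * inv_count (2 * m + 1 - 2 * k) =
          2 * (avoiders_count (k - 1) * inv_count (2 * m - 2 * k)) - avoiders_count (k - 1) * avoiders_count (m - k)"
        unfolding e by (simp add: right_diff_distrib)
    qed
    finally show ?thesis by (simp add: sum_subtractf sum_distrib_left inv_new_def)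
  qed
  have one: "inv_count (2 * m + 1) = 2 * inv_count (2 * m) - avoiders_count m"
  proof (cases m)
    case 0
    then show ?thesis using inv_count_Suc[of 0] inv_count_0 avoiders_count_0 by (simp add: inv_new_def)
  next
    case (Suc l)
    have "(\<Sum>k = 1..m. avoiders_count (k - 1) * avoiders_count (m - k)) = avoiders_count m"
      unfolding Suc avoiders_count_Suc
      by (rule sum.reindex_bij_witness[of _ Suc "\<lambda>k. k - 1"]) auto
    moreover have "inv_count (2 * m) = 2 * inv_count (2 * m - 1)"
      using less[of l] Suc by simp
    moreover have "inv_count (2 * m) = inv_count (2 * m - 1) + inv_new (2 * m)"
      using inv_count_Suc[of "2 * m - 1"] Suc by simp
    moreover have "inv_count (2 * m + 1) = inv_count (2 * m) + inv_new (2 * m + 1)"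
      using inv_count_Suc[of "2 * m"] by simp
    ultimately show ?thesis using odd by linarith
  qed
  \<comment> \<open>The term \<open>k = m + 1\<close> contributes \<open>avoiders_count m\<close>,
    which offsets the deviation in the odd identity.\<close>
  have even: "inv_new (2 * m + 2) = 2 * inv_new (2 * m + 1) + avoiders_count m"
  proof -
    have "inv_new (2 * m + 2) = (\<Sum>k = 1..Suc m. avoiders_count (k - 1) * inv_count (2 * m + 2 - 2 * k))"
      by (simp add: inv_new_def)
    also have "\<dots> = (\<Sum>k = 1..m. avoiders_count (k - 1) * inv_count (2 * m + 2 - 2 * k)) + avoiders_count m"
      using inv_count_0 by simp
    also have "(\<Sum>k = 1..m. avoiders_count (k - 1) * inv_count (2 * m + 2 - 2 * k)) =
        (\<Sum>k = 1..m. 2 * (avoiders_count (k - 1) * inv_count (2 * m + 1 - 2 * k)))"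
    proof (rule sum.cong[OF refl])
      fix k assume k: "k \<in> {1..m}"
      then have e: "2 * m + 1 - 2 * k = 2 * (m - k) + 1" "2 * m + 2 - 2 * k = 2 * (m - k) + 2" by auto
      have "inv_count (2 * (m - k) + 2) = 2 * inv_count (2 * (m - k) + 1)"
        using less[of "m - k"] k by auto
      then show "avoiders_count (k - 1) * inv_count (2 * m + 2 - 2 * k) =
          2 * (avoiders_count (k - 1) * inv_count (2 * m + 1 - 2 * k))"
        unfolding e by simp
    qed
    finally show ?thesis by (simp add: sum_distrib_left inv_new_def)
  qed
  have "inv_count (2 * m + 2) = inv_count (2 * m + 1) + inv_new (2 * m + 2)"
    "inv_count (2 * m + 1) = inv_count (2 * m) + inv_new (2 * m + 1)"
    using inv_count_Suc[of "2 * m + 1"] inv_count_Suc[of "2 * m"] by simp_all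
  then have "inv_count (2 * m + 2) = 2 * inv_count (2 * m + 1)"
    using even one by linarith
  with one show ?case by simp
qed

text \<open>The doubling relations telescope. As the series sums to 2, the right side tends to
  0.\<close>

lemma inv_count_even: "inv_count (2 * m) / 4 ^ m = 1 - (\<Sum>j<m. avoiders_count j / 4 ^ j) / 2"
proof (induction m)
  case 0 then show ?case using inv_count_0 by simp
next
  case (Suc m)
  have "inv_count (2 * Suc m) = 4 * inv_count (2 * m) - 2 * avoiders_count m"
    using inv_count_double[of m] by simp
  then have "inv_count (2 * Suc m) / 4 ^ Suc m = inv_count (2 * m) / 4 ^ m - avoiders_count m / 4 ^ m / 2"
    by (simp add: field_simps)
  then show ?case using Suc by (simp add: add_divide_distrib)
qed

lemma inv_count_ratio_tendsto: "(\<lambda>n. inv_count n / 2 ^ n) \<longlonglongrightarrow> 0"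
proof (rule tendsto_sandwich[of "\<lambda>_. 0"])
  let ?u = "\<lambda>m. inv_count (2 * m) / 4 ^ m"
  have "(\<lambda>m. 1 - (\<Sum>j<m. avoiders_count j / 4 ^ j) / 2) \<longlonglongrightarrow> 1 - 2 / 2"
    using avoiders_count_sums by (intro tendsto_intros) (auto simp: sums_def)
  then have "?u \<longlonglongrightarrow> 0" unfolding inv_count_even by simp
  moreover have "filterlim (\<lambda>n::nat. n div 2) at_top sequentially"
    by (rule filterlim_at_top_div_const_nat) simp
  ultimately show "(\<lambda>n. ?u (n div 2)) \<longlonglongrightarrow> 0" by (rule filterlim_compose)
  show "\<forall>\<^sub>F n in sequentially. inv_count n / 2 ^ n \<le> ?u (n div 2)"
  proof (rule always_eventually, rule allI)
    fix n
    show "inv_count n / 2 ^ n \<le> ?u (n div 2)"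
    proof (cases "even n")
      case True
      then obtain m where "n = 2 * m" by blast
      then show ?thesis by (simp add: power_mult)
    next
      case False
      then obtain m where n: "n = 2 * m + 1" using oddE by blast
      have "inv_count n \<le> 2 * inv_count (2 * m)" using inv_count_double[of m] n by simp
      then have "inv_count n / 2 ^ n \<le> 2 * inv_count (2 * m) / 2 ^ n" by (rule divide_right_mono) simp
      also have "\<dots> = ?u (n div 2)" using n by (simp add: power_mult)
      finally show ?thesis .
    qed
  qed
qed auto

section \<open>Asymptotics\<close>

lemma small_blocks_tendsto: "(\<lambda>n. real (\<Sum>s | 3 * s < n. card (avoiders s)) / 2 ^ n) \<longlonglongrightarrow> 0"
proof (rule tendsto_sandwich[of "\<lambda>_. 0"])
  have bound: "real (\<Sum>s | 3 * s < n. card (avoiders s)) \<le> real n * (2 * 2 powr (2 * real n / 3))" for n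
  proof -
    have "real (\<Sum>s | 3 * s < n. card (avoiders s)) = (\<Sum>s | 3 * s < n. avoiders_count s)" by simp
    also have "\<dots> \<le> (\<Sum>s | 3 * s < n. 2 * 2 powr (2 * real n / 3))"
    proof (rule sum_mono)
      fix s assume "s \<in> {s. 3 * s < n}"
      then have "2 * real s \<le> 2 * real n / 3" by simp
      have "(4::real) ^ s = 2 powr (2 * real s)"
        by (simp add: powr_powr[symmetric] powr_realpow)
      also have "\<dots> \<le> 2 powr (2 * real n / 3)"
        using \<open>2 * real s \<le> 2 * real n / 3\<close> by (intro powr_mono) auto
      finally show "avoiders_count s \<le> 2 * 2 powr (2 * real n / 3)" using avoiders_count_le[of s] by linarith
    qed
    also have "\<dots> = real (card {s. 3 * s < n}) * (2 * 2 powr (2 * real n / 3))" by simp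
    also have "\<dots> \<le> real n * (2 * 2 powr (2 * real n / 3))"
    proof (rule mult_right_mono)
      have "card {s. 3 * s < n} \<le> card {..<n}" by (rule card_mono) auto
      then show "real (card {s. 3 * s < n}) \<le> real n" by simp
    qed simp
    finally show ?thesis .
  qed
  show "\<forall>\<^sub>F n in sequentially. real (\<Sum>s | 3 * s < n. card (avoiders s)) / 2 ^ n \<le> real n * (2 * 2 powr (2 * real n / 3)) / 2 ^ n"
    by (intro always_eventually allI divide_right_mono bound) simp
  show "(\<lambda>n. real n * (2 * 2 powr (2 * real n / 3)) / 2 ^ n) \<longlonglongrightarrow> 0"
    by real_asymp
qed (auto intro!: always_eventually sum_nonneg divide_nonneg_nonneg)

text \<open>The weight 5 ^ j makes the recursion contracting: a three-cycle block contributes total weight at most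
  3 / 20, and 25 / 4 * (3 / 20) < 1 as well as 1 / 2 + 5 / 2 * (3 / 20) < 1.\<close>
definition peak :: "nat \<Rightarrow> real" where
  "peak n = Max ((\<lambda>j. 5 ^ j * real (card (three_cycles_level j n))) ` {..n}) / 2 ^ n"

lemma three_cycles_level_le_peak: "real (card (three_cycles_level j n)) / 2 ^ n \<le> peak n / 5 ^ j"
proof (cases "j \<le> n")
  case True
  then have "5 ^ j * real (card (three_cycles_level j n)) \<le> Max ((\<lambda>j. 5 ^ j * real (card (three_cycles_level j n))) ` {..n})"
    by (intro Max_ge) auto
  then have "5 ^ j * real (card (three_cycles_level j n)) / 2 ^ n \<le> peak n"
    unfolding peak_def by (rule divide_right_mono) simp
  then show ?thesis by (simp add: field_simps)
next
  case False
  have "0 \<le> 5 ^ 0 * real (card (three_cycles_level 0 n)) / 2 ^ n" by simp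
  also have "\<dots> \<le> peak n"
    unfolding peak_def by (intro divide_right_mono Max_ge image_eqI[of _ _ 0]) auto
  finally show ?thesis using False three_cycles_level_empty[of n j] by simp
qed

lemma peak_nonneg: "0 \<le> peak n"
proof -
  have "0 \<le> real (card (three_cycles_level 0 n)) / 2 ^ n" by simp
  also have "\<dots> \<le> peak n / 5 ^ 0" by (rule three_cycles_level_le_peak)
  finally show ?thesis by simp
qed

lemma peak_le:
  assumes "\<And>j. j \<le> n \<Longrightarrow> 5 ^ j * (real (card (three_cycles_level j n)) / 2 ^ n) \<le> B"
  shows "peak n \<le> B"
proof -
  have "Max ((\<lambda>j. 5 ^ j * real (card (three_cycles_level j n))) ` {..n}) \<le> B * 2 ^ n"
    using assms by (intro Max.boundedI) (auto simp: field_simps)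
  then show ?thesis by (simp add: peak_def field_simps)
qed

text \<open>The weight \<open>(1 / 8) ^ k\<close> is the share of the normalisation
  \<open>2 ^ n\<close> belonging to the \<open>3 * k\<close> removed points.\<close>

definition peel_conv :: "nat \<Rightarrow> real" where
  "peel_conv n = (\<Sum>k = 1..n div 3. avoiders_count (k - 1) * (1 / 8) ^ k * peak (n - 3 * k))"

lemma geometric_tail_le: "(\<Sum>i = a..n. (1 / 5 :: real) ^ i) \<le> 5 / 4 * (1 / 5) ^ a"
proof (cases "a \<le> n")
  case True
  then show ?thesis
    by (subst sum_gp) (simp add: field_simps)
qed auto

text \<open>The geometric tail costs \<open>5 / 4\<close>, and a further factor 5 is lost because
  the recursion lets the level drop by one.\<close>

lemma three_cycles_level_le_peel_conv:
  assumes j: "1 \<le> j"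
  shows "5 ^ j * (real (card (three_cycles_level j n)) / 2 ^ n) \<le> 25 / 4 * peel_conv n"
proof -
  have "real (card (three_cycles_level j n)) \<le>
      real (\<Sum>k = 1..n div 3. card (avoiders (k - 1)) * (\<Sum>i = j - 1..n. card (three_cycles_level i (n - 3 * k))))"
    using card_three_cycles_level_le[OF j, of n] by (rule of_nat_mono)
  also have "\<dots> = (\<Sum>k = 1..n div 3. avoiders_count (k - 1) * (\<Sum>i = j - 1..n. real (card (three_cycles_level i (n - 3 * k)))))"
    by simp
  also have "\<dots> \<le> (\<Sum>k = 1..n div 3. 2 ^ n * (5 / 4 * (1 / 5) ^ (j - 1)) * (avoiders_count (k - 1) * (1 / 8) ^ k * peak (n - 3 * k)))"
  proof (rule sum_mono)
    fix k assume k: "k \<in> {1..n div 3}"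
    have "(\<Sum>i = j - 1..n. real (card (three_cycles_level i (n - 3 * k)))) \<le>
        (\<Sum>i = j - 1..n. 2 ^ (n - 3 * k) * peak (n - 3 * k) * (1 / 5) ^ i)"
      using three_cycles_level_le_peak[of _ "n - 3 * k"]
      by (intro sum_mono) (simp add: field_simps)
    also have "\<dots> \<le> 2 ^ (n - 3 * k) * peak (n - 3 * k) * (5 / 4 * (1 / 5) ^ (j - 1))"
      unfolding sum_distrib_left[symmetric]
      by (intro mult_left_mono geometric_tail_le) (simp add: peak_nonneg)
    also have "(2::real) ^ (n - 3 * k) = 2 ^ n * (1 / 8) ^ k"
    proof -
      have "k \<le> n div 3" using k by simp
    then have "n - 3 * k + 3 * k = n" by presburger
      then have "(2::real) ^ n = 2 ^ (n - 3 * k) * 2 ^ (3 * k)" by (metis power_add)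
      also have "(2::real) ^ (3 * k) = 8 ^ k" by (simp add: power_mult)
      finally show ?thesis by (simp add: power_divide)
    qed
    finally have "(\<Sum>i = j - 1..n. real (card (three_cycles_level i (n - 3 * k)))) \<le>
        2 ^ n * (1 / 8) ^ k * peak (n - 3 * k) * (5 / 4 * (1 / 5) ^ (j - 1))" .
    then have "avoiders_count (k - 1) * (\<Sum>i = j - 1..n. real (card (three_cycles_level i (n - 3 * k)))) \<le>
        avoiders_count (k - 1) * (2 ^ n * (1 / 8) ^ k * peak (n - 3 * k) * (5 / 4 * (1 / 5) ^ (j - 1)))"
      by (rule mult_left_mono) simp
    then show "avoiders_count (k - 1) * (\<Sum>i = j - 1..n. real (card (three_cycles_level i (n - 3 * k)))) \<le>
        2 ^ n * (5 / 4 * (1 / 5) ^ (j - 1)) * (avoiders_count (k - 1) * (1 / 8) ^ k * peak (n - 3 * k))"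
      by (simp only: mult_ac)
  qed
  also have "\<dots> = 2 ^ n * (5 / 4 * (1 / 5) ^ (j - 1)) * peel_conv n"
    by (simp add: peel_conv_def sum_distrib_left)
  finally have "real (card (three_cycles_level j n)) / 2 ^ n \<le> 5 / 4 * (1 / 5) ^ (j - 1) * peel_conv n"
    by (simp add: field_simps)
  then have "5 ^ j * (real (card (three_cycles_level j n)) / 2 ^ n) \<le> 5 ^ j * (5 / 4 * (1 / 5) ^ (j - 1) * peel_conv n)"
    by (rule mult_left_mono) simp
  also have "(5::real) ^ j * (5 / 4 * (1 / 5) ^ (j - 1) * peel_conv n) = 25 / 4 * peel_conv n"
    using j by (cases j) (simp_all add: power_divide)
  finally show ?thesis .
qed

section \<open>Contraction of the recursive inequality\<close>

text \<open>The factor 4 combines the two rigid families with inversion.\<close>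

definition remainder :: "nat \<Rightarrow> real" where
  "remainder n = inv_count n / 2 ^ n + 4 * (real (\<Sum>s | 3 * s < n. card (avoiders s)) / 2 ^ n)"

lemma remainder_tendsto: "remainder \<longlonglongrightarrow> 0"
proof -
  have "(\<lambda>n. inv_count n / 2 ^ n + 4 * (real (\<Sum>s | 3 * s < n. card (avoiders s)) / 2 ^ n)) \<longlonglongrightarrow> 0 + 4 * 0"
    by (intro tendsto_intros inv_count_ratio_tendsto small_blocks_tendsto)
  then show ?thesis by (simp add: remainder_def[abs_def])
qed

lemma strong_avoiders_ratio_le:
  "real (card (strong_avoiders (Suc n))) / 2 ^ Suc n \<le> peak n / 2 + 5 / 2 * peel_conv (Suc n) + remainder (Suc n)"
proof -
  let ?E = "\<Sum>s | 3 * s < Suc n. card (avoiders s)"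
  have "card (strong_avoiders (Suc n)) \<le> card (strong_avoiders n) + card (avoiding_involutions (Suc n)) + 2 * (card (three_cycles (Suc n)) + 2 * ?E)"
    using card_strong_avoiders_Suc_le[of n] card_max_left_of_last_le[of "Suc n"]
      card_mono[OF finite_avoiding_involutions, of "{p \<in> avoiding_involutions (Suc n). p (Suc n) \<noteq> Suc n}" "Suc n"] by fastforce
  then have "real (card (strong_avoiders (Suc n))) \<le> real (card (strong_avoiders n) + card (avoiding_involutions (Suc n)) + 2 * (card (three_cycles (Suc n)) + 2 * ?E))"
    by (rule of_nat_mono)
  then have "real (card (strong_avoiders (Suc n))) / 2 ^ Suc n \<le>
      real (card (strong_avoiders n) + card (avoiding_involutions (Suc n)) + 2 * (card (three_cycles (Suc n)) + 2 * ?E)) / 2 ^ Suc n"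
    by (rule divide_right_mono) simp
  also have "\<dots> = real (card (strong_avoiders n)) / 2 ^ n / 2 + 2 * (real (card (three_cycles (Suc n))) / 2 ^ Suc n) + remainder (Suc n)"
    by (simp add: remainder_def add_divide_distrib del: of_nat_sum)
  also have "real (card (strong_avoiders n)) / 2 ^ n \<le> peak n"
    using three_cycles_level_le_peak[of 0 n] by (simp add: three_cycles_level_def)
  also have "real (card (three_cycles (Suc n))) / 2 ^ Suc n \<le> 5 / 4 * peel_conv (Suc n)"
    using three_cycles_level_le_peel_conv[of 1 "Suc n"] unfolding three_cycles_level_1 by simp
  finally show ?thesis by simp
qed

lemma peak_Suc_le:
  "peak (Suc n) \<le> max (25 / 4 * peel_conv (Suc n)) (peak n / 2 + 5 / 2 * peel_conv (Suc n) + remainder (Suc n))"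
proof (rule peak_le)
  fix j
  show "5 ^ j * (real (card (three_cycles_level j (Suc n))) / 2 ^ Suc n) \<le>
      max (25 / 4 * peel_conv (Suc n)) (peak n / 2 + 5 / 2 * peel_conv (Suc n) + remainder (Suc n))"
  proof (cases "j = 0")
    case True
    then show ?thesis using strong_avoiders_ratio_le[of n] by (simp add: three_cycles_level_def)
  next
    case False
    then show ?thesis by (intro max.coboundedI1 three_cycles_level_le_peel_conv) simp
  qed
qed

text \<open>The ratio \<open>4 / 5\<close> is chosen so that
  \<open>(4 / 5) ^ 3 / 4 = 16 / 125\<close> is still at least \<open>1 / 8\<close>. The transient
  term then meets the Catalan series at \<open>1 / 4\<close>, whose shifted partial sums are at most
  1, and is reproduced without loss.\<close>

lemma peel_conv_le:
  assumes "0 \<le> b" "0 \<le> d" and p: "\<And>m. m < n \<Longrightarrow> peak m \<le> b + d * (4 / 5) ^ m"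
  shows "peel_conv n \<le> 3 / 20 * b + d * (4 / 5) ^ n"
proof -
  have "peel_conv n \<le> (\<Sum>k = 1..n div 3. b * (avoiders_count (k - 1) * (1 / 8) ^ k) + d * (4 / 5) ^ n * (avoiders_count (k - 1) * (1 / 4) ^ k))"
    unfolding peel_conv_def
  proof (rule sum_mono)
    fix k assume k: "k \<in> {1..n div 3}"
    have "k \<le> n div 3" using k by simp
    then have "n - 3 * k + 3 * k = n" by presburger
    then have "(4 / 5 :: real) ^ n = (4 / 5) ^ (n - 3 * k) * (4 / 5) ^ (3 * k)" by (metis power_add)
    then have e: "(4 / 5 :: real) ^ n * (1 / 4) ^ k = (4 / 5) ^ (n - 3 * k) * (16 / 125) ^ k"
      by (simp add: power_mult power_mult_distrib[symmetric] power3_eq_cube mult.assoc)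
    have "(1 / 8 :: real) ^ k \<le> (16 / 125) ^ k" by (rule power_mono) auto
    then have "(4 / 5) ^ (n - 3 * k) * (1 / 8) ^ k \<le> (4 / 5 :: real) ^ n * (1 / 4) ^ k"
      unfolding e by (rule mult_left_mono) simp
    then have q: "(avoiders_count (k - 1) * d) * ((4 / 5) ^ (n - 3 * k) * (1 / 8) ^ k) \<le> (avoiders_count (k - 1) * d) * ((4 / 5) ^ n * (1 / 4) ^ k)"
      using assms by (intro mult_left_mono) auto
    have "avoiders_count (k - 1) * (1 / 8) ^ k * peak (n - 3 * k) \<le> avoiders_count (k - 1) * (1 / 8) ^ k * (b + d * (4 / 5) ^ (n - 3 * k))"
      using k by (intro mult_left_mono p) auto
    also have "\<dots> \<le> b * (avoiders_count (k - 1) * (1 / 8) ^ k) + d * (4 / 5) ^ n * (avoiders_count (k - 1) * (1 / 4) ^ k)"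
      using q by (simp add: distrib_left mult_ac)
    finally show "avoiders_count (k - 1) * (1 / 8) ^ k * peak (n - 3 * k) \<le>
       b * (avoiders_count (k - 1) * (1 / 8) ^ k) + d * (4 / 5) ^ n * (avoiders_count (k - 1) * (1 / 4) ^ k)" .
  qed
  also have "\<dots> = b * (\<Sum>k = 1..n div 3. avoiders_count (k - 1) * (1 / 8) ^ k) + d * (4 / 5) ^ n * (\<Sum>k = 1..n div 3. avoiders_count (k - 1) * (1 / 4) ^ k)"
    by (simp only: sum.distrib sum_distrib_left)
  also have "\<dots> \<le> b * (3 / 20) + d * (4 / 5) ^ n * 1"
  proof (intro add_mono mult_left_mono)
    \<comment> \<open>\<open>6 / 5\<close> is a rational supersolution at \<open>1 / 8\<close>, as
      \<open>1 + 36 / 200 \<le> 6 / 5\<close>; the index shift multiplies it by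
      \<open>1 / 8\<close>.\<close>
    show "(\<Sum>k = 1..n div 3. avoiders_count (k - 1) * (1 / 8) ^ k) \<le> 3 / 20"
      unfolding sum_shift_avoiders_count using sum_avoiders_count_power_le[of "1 / 8" "6 / 5" "n div 3"] by (simp add: power2_eq_square)
    show "(\<Sum>k = 1..n div 3. avoiders_count (k - 1) * (1 / 4) ^ k) \<le> 1"
      unfolding sum_shift_avoiders_count using sum_avoiders_count_power_le[of "1 / 4" 2 "n div 3"] by simp
  qed (use assms in auto)
  finally show ?thesis by simp
qed

lemma peak_bounded: "\<exists>B > 0. \<forall>n. peak n \<le> B"
proof -
  obtain H where H: "H > 0" "\<And>n. norm (remainder n) \<le> H"
    using convergent_imp_Bseq[OF convergentI[OF remainder_tendsto]] by (auto simp: Bseq_def)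
  \<comment> \<open>The factor 8 makes the induction close exactly:
    \<open>1 / 2 + 5 / 2 * (3 / 20) + 1 / 8 = 1\<close>.\<close>
  define B where "B = max (peak 0) (8 * H)"
  have B: "B > 0" using H(1) by (simp add: B_def)
  have "peak n \<le> B" for n
  proof (induction n rule: less_induct)
    case (less n)
    show ?case
    proof (cases n)
      case 0 then show ?thesis by (simp add: B_def)
    next
      case (Suc m)
      have "peel_conv n \<le> 3 / 20 * B + 0 * (4 / 5) ^ n"
        by (rule peel_conv_le) (use less B in auto)
      moreover have "remainder n \<le> B / 8" using H(2)[of n] by (simp add: B_def)
      moreover have "peak m \<le> B" using less Suc by simp
      ultimately show ?thesis using peak_Suc_le[of m] B Suc by (auto simp: max_def split: if_splits)
    qed
  qed
  with B show ?thesis by blast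
qed

text \<open>The two branches of \<open>peak_Suc_le\<close> have factors \<open>15 / 16\<close> and
  \<open>7 / 8\<close> in the limit; the gap up to \<open>19 / 20\<close> absorbs the two errors
  \<open>b / 1000\<close>.\<close>

lemma peak_contract:
  assumes b: "0 < b" and ev: "\<forall>\<^sub>F n in sequentially. peak n \<le> b"
  shows "\<forall>\<^sub>F n in sequentially. peak n \<le> 19 / 20 * b"
proof -
  obtain B where B: "B > 0" "\<And>n. peak n \<le> B" using peak_bounded by blast
  obtain M where M: "\<And>n. M \<le> n \<Longrightarrow> peak n \<le> b" using ev by (auto simp: eventually_sequentially)
  \<comment> \<open>Chosen so that for indices below \<open>M\<close> the transient term alone
    dominates the global bound \<open>B\<close>.\<close>
  define d where "d = B / (4 / 5) ^ M"
  have d: "0 \<le> d" using B by (simp add: d_def)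
  have p: "peak m \<le> b + d * (4 / 5) ^ m" for m
  proof (cases "M \<le> m")
    case True
    have "0 \<le> d * (4 / 5) ^ m" using d by simp
    then show ?thesis using M[OF True] by linarith
  next
    case False
    then have "(4 / 5 :: real) ^ M \<le> (4 / 5) ^ m" by (intro power_decreasing) auto
    then have "d * (4 / 5) ^ M \<le> d * (4 / 5) ^ m" using d by (rule mult_left_mono)
    then show ?thesis using B(2)[of m] b by (simp add: d_def)
  qed
  have cv: "peel_conv n \<le> 3 / 20 * b + d * (4 / 5) ^ n" for n
    by (rule peel_conv_le) (use b d p in auto)
  have t1: "(\<lambda>n. d * (4 / 5) ^ n) \<longlonglongrightarrow> 0"
    by (rule tendsto_mult_right_zero) (rule LIMSEQ_power_zero, simp)
  have e1: "\<forall>\<^sub>F n in sequentially. d * (4 / 5) ^ n < b / 1000"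
    by (rule order_tendstoD(2)[OF t1]) (use b in simp)
  have e2: "\<forall>\<^sub>F n in sequentially. remainder n < b / 1000"
    by (rule order_tendstoD(2)[OF remainder_tendsto]) (use b in simp)
  have e3: "\<forall>\<^sub>F n in sequentially. M + 1 \<le> n" by (rule eventually_ge_at_top)
  from e1 e2 e3 show ?thesis
  proof eventually_elim
    case (elim n)
    then obtain m where m: "n = Suc m" "M \<le> m" by (cases n) auto
    have "peel_conv n \<le> 3 / 20 * b + b / 1000" using cv[of n] elim by linarith
    moreover have "peak m \<le> b" using M m by simp
    ultimately show ?case using peak_Suc_le[of m] m elim b by (auto simp: max_def split: if_splits)
  qed
qed

lemma strong_avoiders_ratio_less:
  assumes e: "0 < e"
  shows "\<forall>\<^sub>F n in sequentially. real (card (strong_avoiders n)) < e * 2 ^ n"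
proof -
  obtain B where B: "B > 0" "\<And>n. peak n \<le> B" using peak_bounded by blast
  have it: "\<forall>\<^sub>F n in sequentially. peak n \<le> (19 / 20) ^ N * B" for N
  proof (induction N)
    case 0 then show ?case using B by simp
  next
    case (Suc N)
    then show ?case using peak_contract[of "(19 / 20) ^ N * B"] B by (simp add: mult.assoc)
  qed
  have "(\<lambda>N. (19 / 20 :: real) ^ N * B) \<longlonglongrightarrow> 0"
    by (rule tendsto_mult_left_zero) (rule LIMSEQ_power_zero, simp)
  then have "\<forall>\<^sub>F N in sequentially. (19 / 20) ^ N * B < e"
    by (rule order_tendstoD(2)) (rule e)
  then obtain N where N: "(19 / 20) ^ N * B < e" by (auto simp: eventually_sequentially)
  show ?thesis using it[of N]
  proof eventually_elim
    case (elim n)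
    have "real (card (strong_avoiders n)) / 2 ^ n \<le> peak n"
      using three_cycles_level_le_peak[of 0 n] by (simp add: three_cycles_level_def)
    then have "real (card (strong_avoiders n)) / 2 ^ n < e" using elim N by linarith
    then show ?case by (simp add: field_simps)
  qed
qed

section \<open>Lower bound from the involutions\<close>

lemma inv_count_ge_1: "1 \<le> inv_count n"
proof (induction n)
  case 0 then show ?case by (simp add: inv_count_0)
next
  case (Suc n)
  then show ?case using card_avoiding_involutions_Suc[of n] by simp
qed

text \<open>\<open>y ^ n\<close> is a subsolution of the involution recursion once
  \<open>1 / y\<close> plus the Catalan weights at \<open>1 / y\<^sup>2\<close> reach 1. At
  \<open>y = 2\<close> the full series gives exactly 1; for \<open>y < 2\<close> the excess of
  \<open>1 / y\<close> over \<open>1 / 2\<close> permits truncation at some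
  \<open>K\<close>.\<close>

lemma inv_count_growth:
  assumes y: "1 < y" "y < 2"
  shows "\<exists>\<delta> > 0. \<forall>n. \<delta> * y ^ n \<le> inv_count n"
proof -
  have "(\<lambda>K. (\<Sum>i<K. avoiders_count i / 4 ^ i) / 4) \<longlonglongrightarrow> 2 / 4"
    using avoiders_count_sums by (intro tendsto_intros) (auto simp: sums_def)
  moreover have "1 - 1 / y < 2 / 4" using y by (simp add: field_simps)
  ultimately have "\<forall>\<^sub>F K in sequentially. 1 - 1 / y < (\<Sum>i<K. avoiders_count i / 4 ^ i) / 4"
    by (rule order_tendstoD(1))
  then obtain K where K: "1 - 1 / y < (\<Sum>i<K. avoiders_count i / 4 ^ i) / 4"
    by (auto simp: eventually_sequentially)
  have "(\<Sum>i<K. avoiders_count i / 4 ^ i) / 4 = (\<Sum>k = 1..K. avoiders_count (k - 1) * (1 / 4) ^ k)"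
    unfolding sum_shift_avoiders_count by (simp add: power_divide)
  also have "\<dots> \<le> (\<Sum>k = 1..K. avoiders_count (k - 1) * (1 / y\<^sup>2) ^ k)"
  proof (intro sum_mono mult_left_mono power_mono)
    have "y\<^sup>2 \<le> 2\<^sup>2" using y by (intro power_mono) auto
    then show "1 / 4 \<le> 1 / y\<^sup>2" using y by (intro divide_left_mono) auto
  qed auto
  finally have key: "1 \<le> 1 / y + (\<Sum>k = 1..K. avoiders_count (k - 1) * (1 / y\<^sup>2) ^ k)" using K by linarith
  \<comment> \<open>Makes the bound at most 1 up to index \<open>2 * K\<close>; beyond that, all the
    indices \<open>n - 2 * k\<close> with \<open>k \<le> K\<close> are covered by the
    induction.\<close>
  define \<delta> where "\<delta> = 1 / y ^ (2 * K)"
  have \<delta>: "\<delta> > 0" using y by (simp add: \<delta>_def)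
  have "\<delta> * y ^ n \<le> inv_count n" for n
  proof (induction n rule: less_induct)
    case (less n)
    show ?case
    proof (cases "n \<le> 2 * K")
      case True
      then have "y ^ n \<le> y ^ (2 * K)" using y by (intro power_increasing) auto
      then have "\<delta> * y ^ n \<le> 1" using y by (simp add: \<delta>_def field_simps)
      then show ?thesis using inv_count_ge_1[of n] by linarith
    next
      case False
      then obtain m where m: "n = Suc m" by (cases n) auto
      have "\<delta> * y ^ n = \<delta> * y ^ n * 1" by simp
      also have "\<dots> \<le> \<delta> * y ^ n * (1 / y + (\<Sum>k = 1..K. avoiders_count (k - 1) * (1 / y\<^sup>2) ^ k))"
        using key \<delta> y by (intro mult_left_mono) auto
      also have "\<dots> = \<delta> * y ^ m + (\<Sum>k = 1..K. avoiders_count (k - 1) * (\<delta> * (y ^ n * (1 / y\<^sup>2) ^ k)))"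
        using y m by (simp add: distrib_left sum_distrib_left mult_ac)
      also have "\<dots> = \<delta> * y ^ m + (\<Sum>k = 1..K. avoiders_count (k - 1) * (\<delta> * y ^ (n - 2 * k)))"
      proof -
        have "y ^ n * (1 / y\<^sup>2) ^ k = y ^ (n - 2 * k)" if "k \<in> {1..K}" for k
        proof -
          have "y ^ n = y ^ (n - 2 * k) * y ^ (2 * k)" using that False by (simp add: power_add[symmetric])
          then show ?thesis using y by (simp add: power_mult power_divide)
        qed
        then show ?thesis by simp
      qed
      also have "\<dots> \<le> inv_count m + (\<Sum>k = 1..K. avoiders_count (k - 1) * inv_count (n - 2 * k))"
        using less False m by (intro add_mono sum_mono mult_left_mono) auto
      also have "\<dots> \<le> inv_count m + inv_new n"
        unfolding inv_new_def using False by (intro add_left_mono sum_mono2) auto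
      also have "\<dots> = inv_count n" using inv_count_Suc[of m] m by simp
      finally show ?thesis .
    qed
  qed
  with \<delta> show ?thesis by blast
qed

lemma num_eq: "num_strongly_avoiding132 n = card (strong_avoiders n)"
  by (simp add: num_strongly_avoiding132_def strong_avoiders_def)

theorem corollary4p4:
  shows "(\<lambda>n. root n (real (num_strongly_avoiding132 n))) \<longlonglongrightarrow> 2 \<and>
         (\<forall>\<^sub>F n in sequentially. num_strongly_avoiding132 n < 2 ^ n)"
proof
  have small: "\<forall>\<^sub>F n in sequentially. real (num_strongly_avoiding132 n) < 2 ^ n"
    using strong_avoiders_ratio_less[of 1] by (simp add: num_eq)
  then show "\<forall>\<^sub>F n in sequentially. num_strongly_avoiding132 n < 2 ^ n"
    by eventually_elim (metis of_nat_less_iff of_nat_numeral of_nat_power)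
  show "(\<lambda>n. root n (real (num_strongly_avoiding132 n))) \<longlonglongrightarrow> 2"
  proof (rule order_tendstoI)
    fix a :: real assume a: "2 < a"
    show "\<forall>\<^sub>F n in sequentially. root n (real (num_strongly_avoiding132 n)) < a"
      using small eventually_gt_at_top[of 0]
    proof eventually_elim
      case (elim n)
      then have "root n (real (num_strongly_avoiding132 n)) < root n (2 ^ n)" by simp
      also have "root n (2 ^ n) = 2" using elim by (simp add: real_root_power_cancel)
      finally show ?case using a by simp
    qed
  next
    fix a :: real assume a: "a < 2"
    \<comment> \<open>The maximum with 1 keeps \<open>y > 1\<close> for every \<open>a\<close>, as
      \<open>inv_count_growth\<close> requires.\<close>
    define y where "y = (max a 1 + 2) / 2"
    have y: "1 < y" "y < 2" "a < y" using a by (auto simp: y_def)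
    obtain \<delta> where \<delta>: "\<delta> > 0" "\<And>n. \<delta> * y ^ n \<le> inv_count n" using inv_count_growth[OF y(1,2)] by blast
    have "(\<lambda>n. root n \<delta> * y) \<longlonglongrightarrow> 1 * y"
      by (intro tendsto_intros LIMSEQ_root_const \<delta>(1))
    then have "\<forall>\<^sub>F n in sequentially. a < root n \<delta> * y"
      by (rule order_tendstoD(1)) (use y in simp)
    then show "\<forall>\<^sub>F n in sequentially. a < root n (real (num_strongly_avoiding132 n))"
      using eventually_gt_at_top[of 0]
    proof eventually_elim
      case (elim n)
      have "\<delta> * y ^ n \<le> real (num_strongly_avoiding132 n)"
        using \<delta>(2)[of n] card_mono[OF finite_strong_avoiders avoiding_involutions_subset_strong_avoiders, of n] by (simp add: num_eq)
      then have "root n (\<delta> * y ^ n) \<le> root n (real (num_strongly_avoiding132 n))"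
        using elim by simp
      moreover have "root n (\<delta> * y ^ n) = root n \<delta> * y"
        using elim y by (simp add: real_root_mult real_root_power_cancel)
      ultimately show ?case using elim by linarith
    qed
  qed
qed

end
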